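(* For $n\ge1$, let $C_n$ be the Cartan matrix of $\mathrm A_n$. Then for all $L\in\mathbb Z$, $$\sum_{m\in\mathbb Z^n}q^{\frac12 mC_nm}\prod_{j=1}^n\genfrac{[}{]}{0pt}{}{L\delta_{j,1}+m_j-(C_nm)_j}{m_j}$$ $$=\sum_{j=-\infty}^{\infty}\Bigl\{q^{\frac12 j((n+3)(n+4)j+2)}\genfrac{[}{]}{0pt}{}{L}{(n+4)j}_2-q^{\frac12((n+3)j+2)((n+4)j+2)}\genfrac{[}{]}{0pt}{}{L}{(n+4)j+2}_2\Bigr\}.$$
   Context: $q$ is an indeterminate. $(q)_0=1$, $(q)_n=\prod_{j=1}^n(1-q^j)$ for $n\ge1$. $\genfrac{[}{]}{0pt}{}{n}{a}=\frac{(q)_n}{(q)_a(q)_{n-a}}$ if $0\le a\le n$, and $0$ otherwise (in particular $0$ if $n<0$). The $q$-trinomial coefficients are $$\genfrac{[}{]}{0pt}{}{L,b}{a}_2=\sum_{k\ge0}q^{k(k+b)}\genfrac{[}{]}{0pt}{}{L}{k}\genfrac{[}{]}{0pt}{}{L-k}{k+a},\qquad \genfrac{[}{]}{0pt}{}{L}{a}_2=\genfrac{[}{]}{0pt}{}{L,a}{a}_2 .$$ The Cartan matrix $C_n$ of $\mathrm A_n$ has entries $(C_n)_{i,j}=2\delta_{i,j}-\delta_{|i-j|,1}$, $1\le i,j\le n$. Notation: $mC_nm=\sum_{j,k}m_j(C_n)_{j,k}m_k$ and $(C_nm)_j=\sum_k(C_n)_{j,k}m_k$. *)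

theory Defs
  imports
    "HOL-Computational_Algebra.Fraction_Field"
    "HOL-Computational_Algebra.Polynomial"
    "HOL-Library.FuncSet"
begin

text \<open>
  All identities are between elements of the field of rational functions in one indeterminate.

  Sums over infinite index sets are rendered by \<^const>\<open>sum'\<close>, the sum of all non-zero terms,
  which is meaningful if only finitely many terms are non-zero. The lemmas named
  \<open>finite_support_...\<close> show that this holds for every such sum used here. Exponents
  of the form \<open>e/2\<close> are written \<open>e div 2\<close>; the lemmas named \<open>even_...\<close> show that
  these divisions are exact.
\<close>

definition q :: "rat poly fract" where
  "q = Fraction_Field.Fract [:0, 1:] 1"

definition qpoch :: "nat \<Rightarrow> rat poly fract" where
  "qpoch n = (\<Prod>j=1..n. 1 - q ^ j)"

definition qbinom :: "int \<Rightarrow> int \<Rightarrow> rat poly fract" where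
  "qbinom n a =
     (if 0 \<le> a \<and> a \<le> n then qpoch (nat n) / (qpoch (nat a) * qpoch (nat (n - a))) else 0)"

definition qtrinom2 :: "int \<Rightarrow> int \<Rightarrow> int \<Rightarrow> rat poly fract" where
  "qtrinom2 L b a = sum' (\<lambda>k. q powi (k * (k + b)) * qbinom L k * qbinom (L - k) (k + a)) {0..}"

abbreviation qtrinom :: "int \<Rightarrow> int \<Rightarrow> rat poly fract" where
  "qtrinom L a \<equiv> qtrinom2 L a a"

text \<open>
  The entries of the Cartan matrix of type A do not depend on its size \<open>n\<close>; the size enters
  through the range \<open>{1..n}\<close> of the indices. Vectors in \<open>\<int>\<^sup>n\<close> are
  extensional functions on \<open>{1..n}\<close>, so that each vector is counted exactly once.
\<close>

definition cartan_A :: "nat \<Rightarrow> nat \<Rightarrow> int" where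
  "cartan_A i j = 2 * of_bool (i = j) - of_bool (\<bar>int i - int j\<bar> = 1)"

definition cartan_mult :: "nat \<Rightarrow> (nat \<Rightarrow> int) \<Rightarrow> nat \<Rightarrow> int" where
  "cartan_mult n m j = (\<Sum>k=1..n. cartan_A j k * m k)"

definition cartan_form :: "nat \<Rightarrow> (nat \<Rightarrow> int) \<Rightarrow> int" where
  "cartan_form n m = (\<Sum>j=1..n. \<Sum>k=1..n. m j * cartan_A j k * m k)"

abbreviation int_vectors :: "nat \<Rightarrow> (nat \<Rightarrow> int) set" where
  "int_vectors n \<equiv> {1..n} \<rightarrow>\<^sub>E UNIV"


lemma qbinom_nonzeroD: "qbinom n a \<noteq> 0 \<Longrightarrow> 0 \<le> a \<and> a \<le> n"
  by (auto simp: qbinom_def split: if_splits)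

lemma finite_support_qtrinom2:
  "finite {k \<in> {0..}. q powi (k * (k + b)) * qbinom L k * qbinom (L - k) (k + a) \<noteq> 0}"
  by (rule finite_subset[of _ "{0..L}"]) (auto dest: qbinom_nonzeroD)

lemma qtrinom2_nonzeroD:
  assumes "qtrinom2 L b a \<noteq> 0"
  shows "\<bar>a\<bar> \<le> L"
proof (rule ccontr)
  assume *: "\<not> \<bar>a\<bar> \<le> L"
  have "q powi (k * (k + b)) * qbinom L k * qbinom (L - k) (k + a) = 0" for k
    using qbinom_nonzeroD[of L k] qbinom_nonzeroD[of "L - k" "k + a"] * by fastforce
  then show False
    using assms by (simp add: qtrinom2_def sum.G_def)
qed

lemma finite_support_qtrinom_series:
  "finite {j. q powi (j * ((int n + 3) * (int n + 4) * j + 2) div 2) * qtrinom L ((int n + 4) * j)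
            - q powi (((int n + 3) * j + 2) * ((int n + 4) * j + 2) div 2)
                * qtrinom L ((int n + 4) * j + 2) \<noteq> 0}"
proof (rule finite_subset)
  have *: "\<bar>j\<bar> \<le> \<bar>(int n + 4) * j\<bar>" for j
    using mult_right_mono[of 1 "int n + 4" "\<bar>j\<bar>"] by (simp add: abs_mult)
  show "{j. q powi (j * ((int n + 3) * (int n + 4) * j + 2) div 2) * qtrinom L ((int n + 4) * j)
            - q powi (((int n + 3) * j + 2) * ((int n + 4) * j + 2) div 2)
                * qtrinom L ((int n + 4) * j + 2) \<noteq> 0} \<subseteq> {- (L + 2)..L + 2}"
  proof
    fix j assume "j \<in> {j. q powi (j * ((int n + 3) * (int n + 4) * j + 2) div 2)
                * qtrinom L ((int n + 4) * j)
            - q powi (((int n + 3) * j + 2) * ((int n + 4) * j + 2) div 2)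
                * qtrinom L ((int n + 4) * j + 2) \<noteq> 0}"
    then have "qtrinom L ((int n + 4) * j) \<noteq> 0 \<or> qtrinom L ((int n + 4) * j + 2) \<noteq> 0"
      by auto
    then have "\<bar>(int n + 4) * j\<bar> \<le> L \<or> \<bar>(int n + 4) * j + 2\<bar> \<le> L"
      using qtrinom2_nonzeroD by blast
    with *[of j] show "j \<in> {- (L + 2)..L + 2}"
      by auto
  qed
qed simp

lemma even_exponent1: "even (j * ((int n + 3) * (int n + 4) * j + 2))"
  by auto

lemma even_exponent2: "even (((int n + 3) * j + 2) * ((int n + 4) * j + 2))"
  by auto

lemma cartan_mult_expand:
  assumes "j \<in> {1..n}"
  shows "cartan_mult n m j =
    2 * m j - (if j > 1 then m (j - 1) else 0) - (if j < n then m (j + 1) else 0)"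
proof -
  have "cartan_A j k * m k = (if k = j then 2 * m j else 0)
      - (if k = j - 1 then (if j > 1 then m (j - 1) else 0) else 0)
      - (if k = j + 1 then m (j + 1) else 0)" if "k \<in> {1..n}" for k
    using that assms by (auto simp: cartan_A_def)
  then have "cartan_mult n m j = (\<Sum>k=1..n. (if k = j then 2 * m j else 0)
      - (if k = j - 1 then (if j > 1 then m (j - 1) else 0) else 0)
      - (if k = j + 1 then m (j + 1) else 0))"
    unfolding cartan_mult_def by (intro sum.cong) auto
  also have "\<dots> = 2 * m j - (if j > 1 then m (j - 1) else 0) - (if j < n then m (j + 1) else 0)"
    using assms by (auto simp: sum_subtractf sum.delta)
  finally show ?thesis .
qed

lemma even_cartan_form: "even (cartan_form n m)"
proof (induction n)
  case (Suc n)
  have "(\<Sum>k=1..n. m (Suc n) * cartan_A (Suc n) k * m k)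
      = (\<Sum>j=1..n. m j * cartan_A j (Suc n) * m (Suc n))"
    by (intro sum.cong) (auto simp: cartan_A_def)
  moreover have "cartan_A (Suc n) (Suc n) = 2"
    by (simp add: cartan_A_def)
  ultimately have "cartan_form (Suc n) m = cartan_form n m
      + 2 * (\<Sum>j=1..n. m j * cartan_A j (Suc n) * m (Suc n)) + 2 * (m (Suc n))\<^sup>2"
    by (simp add: cartan_form_def sum.distrib power2_eq_square)
  with Suc show ?case by simp
qed (simp add: cartan_form_def)

lemma finite_support_vectors:
  "finite {m \<in> int_vectors n. q powi (cartan_form n m div 2) *
     (\<Prod>j=1..n. qbinom (L * of_bool (j = 1) + m j - cartan_mult n m j) (m j)) \<noteq> 0}"
proof (rule finite_subset)
  show "{m \<in> int_vectors n. q powi (cartan_form n m div 2) *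
     (\<Prod>j=1..n. qbinom (L * of_bool (j = 1) + m j - cartan_mult n m j) (m j)) \<noteq> 0}
     \<subseteq> {1..n} \<rightarrow>\<^sub>E {0..L}"
  proof
    fix m
    assume m: "m \<in> {m \<in> int_vectors n. q powi (cartan_form n m div 2) *
     (\<Prod>j=1..n. qbinom (L * of_bool (j = 1) + m j - cartan_mult n m j) (m j)) \<noteq> 0}"
    then have "\<forall>j\<in>{1..n}. qbinom (L * of_bool (j = 1) + m j - cartan_mult n m j) (m j) \<noteq> 0"
      by auto
    then have nonneg: "0 \<le> m j" and le: "cartan_mult n m j \<le> L * of_bool (j = 1)"
      if "j \<in> {1..n}" for j
      using that qbinom_nonzeroD by fastforce+
    have dec: "(if j < n then m (j + 1) else 0) \<le> m j" if "1 \<le> j" "j \<le> n" for j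
      using that(2,1)
    proof (induction j rule: inc_induct)
      case base
      with nonneg[of n] show ?case by simp
    next
      case (step i)
      with le[of "Suc i"] show ?case
        by (auto simp: cartan_mult_expand split: if_splits)
    qed
    have bound: "m j \<le> L" if "1 \<le> j" "j \<le> n" for j
      using that
    proof (induction j rule: dec_induct)
      case base
      with le[of 1] dec[of 1] show ?case
        by (auto simp: cartan_mult_expand split: if_splits)
    next
      case (step i)
      with dec[of i] show ?case by simp
    qed
    show "m \<in> {1..n} \<rightarrow>\<^sub>E {0..L}"
      using m nonneg bound by (auto simp: PiE_iff)
  qed
qed (intro finite_PiE, auto)

end

theory Submission
  imports Defs
begin

text \<open>
  The proof uses Warnaar's refined \<open>q\<close>-trinomial coefficients, here in a normalisation without
  half-integral powers of \<open>q\<close>: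
  \<open>T(L,M;a,b) = \<Sum> q^(n L + 2 x y) [M; n] [M+b+x; x] [M-b+y; y]\<close>,
  summed over \<open>n + x + y = L\<close> with \<open>y - x = a\<close>. They satisfy two summation formulas for \<open>a b \<ge> 0\<close>:
  \<open>\<Sum>\<^sub>l q^(L (L-l)) [M+l; L] T(l,L-l;a,b) = q^(b (a+b)) T(L,M;a+b,b)\<close> and
  \<open>\<Sum>\<^sub>l T(l,L-l;a,b) = [L; a+b]\<^sub>2\<close>.
  Both follow by induction from contiguous relations, first for \<open>b = 0\<close> and then from \<open>b - 1\<close> to \<open>b\<close>.
  Starting from
  \<open>\<Sum>\<^sub>j (q^(6j\<^sup>2-j) T(L,M;3j,j) - q^(6j\<^sup>2+7j+2) T(L,M;3j+2,j)) = \<delta>(L,0)\<close>,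
  whose left side telescopes in \<open>M\<close>, one applies the first formula \<open>n\<close> times and the second one
  once. On the delta side this builds up the sum over \<open>m\<^sub>1, \<dots>, m\<^sub>n\<close>, one variable at a time;
  on the other side the first argument \<open>3 j\<close> becomes \<open>(n + 4) j\<close>.
\<close>

section \<open>Gaussian binomial coefficients\<close>

lemma q_power: "q ^ n = Fraction_Field.Fract (monom 1 n) 1"
  by (induction n) (auto simp: q_def One_fract_def monom_Suc monom_0 one_pCons)

lemma q_nonzero [simp]: "q \<noteq> 0"
  by (simp add: q_def Zero_fract_def eq_fract)

text \<open>Since \<open>q\<close> is no root of unity, every \<open>qpoch n\<close> is invertible
  and denominators can be cleared.\<close>

lemma q_power_eq_1_iff: "q ^ n = 1 \<longleftrightarrow> n = 0"
proof -
  have "q ^ n = 1 \<longleftrightarrow> monom 1 n = (1 :: rat poly)"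
    by (simp add: q_power One_fract_def eq_fract)
  also have "\<dots> \<longleftrightarrow> n = 0"
    by (metis degree_1 degree_monom_eq monom_0 one_neq_zero one_pCons)
  finally show ?thesis .
qed

lemma q_powi_add: "q powi (m + n) = q powi m * q powi n"
  by (simp add: power_int_add)

lemma qpoch_0 [simp]: "qpoch 0 = 1"
  by (simp add: qpoch_def)

lemma qpoch_Suc: "qpoch (Suc n) = qpoch n * (1 - q ^ Suc n)"
  by (simp add: qpoch_def)

lemma qpoch_nonzero [simp]: "qpoch n \<noteq> 0"
  using q_power_eq_1_iff by (auto simp: qpoch_def)

lemma qpoch_nat_rec:
  assumes "n \<ge> 1"
  shows "qpoch (nat n) = qpoch (nat (n - 1)) * (1 - q powi n)"
proof -
  obtain k where n: "n = int (Suc k)"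
    using assms by (metis Suc_diff_1 int_nat_eq nat_0_iff not_gr_zero not_one_le_zero zero_le_one order_trans)
  show ?thesis unfolding n
    by (metis One_nat_def add_diff_cancel_left' nat_int of_nat_Suc power_int_of_nat qpoch_Suc)
qed

lemma qbinom_neg: "a < 0 \<Longrightarrow> qbinom n a = 0" and qbinom_gt: "n < a \<Longrightarrow> qbinom n a = 0"
  by (auto simp: qbinom_def)

lemma qbinom_0 [simp]: "0 \<le> n \<Longrightarrow> qbinom n 0 = 1" and qbinom_same: "0 \<le> n \<Longrightarrow> qbinom n n = 1"
  by (auto simp: qbinom_def)

text \<open>With the common factor \<open>P\<close> the rule reads 1 - q^n = (1 - q^(n-a)) + q^(n-a)
  (1 - q^a). It fails at \<open>n = a = 0\<close>: the left side is 1, but both binomials with upper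
  entry -1 vanish.\<close>

lemma qbinom_pascal:
  assumes "n \<noteq> 0 \<or> a \<noteq> 0"
  shows "qbinom n a = qbinom (n - 1) a + q powi (n - a) * qbinom (n - 1) (a - 1)"
proof (cases "1 \<le> a \<and> a \<le> n - 1")
  case True
  define P where "P = qpoch (nat (n - 1)) / (qpoch (nat a) * qpoch (nat (n - a)))"
  have 1: "qbinom n a = P * (1 - q powi n)"
    using True by (simp add: qbinom_def P_def qpoch_nat_rec[of n])
  have "qpoch (nat (n - a)) = qpoch (nat (n - 1 - a)) * (1 - q powi (n - a))"
    using qpoch_nat_rec[of "n - a"] True by (simp add: algebra_simps)
  moreover from this have "1 - q powi (n - a) \<noteq> 0"
    using qpoch_nonzero[of "nat (n - a)"] by auto
  ultimately have 2: "qbinom (n - 1) a = P * (1 - q powi (n - a))"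
    using True by (simp add: qbinom_def P_def)
  have "qpoch (nat a) = qpoch (nat (a - 1)) * (1 - q powi a)"
    using qpoch_nat_rec[of a] True by simp
  moreover from this have "1 - q powi a \<noteq> 0"
    using qpoch_nonzero[of "nat a"] by auto
  ultimately have 3: "qbinom (n - 1) (a - 1) = P * (1 - q powi a)"
    using True by (simp add: qbinom_def P_def)
  show ?thesis
    using q_powi_add[of "n - a" a] by (simp add: 1 2 3 algebra_simps)
next
  case False
  then consider "a < 0" | "a = 0" | "a = n" "a > 0" | "a > n" by linarith
  then show ?thesis
    using assms by cases (auto simp: qbinom_def)
qed

section \<open>Refined trinomial coefficients\<close>

text \<open>Support in nonnegative indices frees \<open>tri_sum\<close> from its summation range, so
  index shifts are valid for all integers \<open>L\<close> and \<open>a\<close>.\<close>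

definition tri_supported :: "(int \<Rightarrow> int \<Rightarrow> int \<Rightarrow> 'a::comm_monoid_add) \<Rightarrow> bool" where
  "tri_supported f \<longleftrightarrow> (\<forall>n x y. f n x y \<noteq> 0 \<longrightarrow> 0 \<le> n \<and> 0 \<le> x \<and> 0 \<le> y)"

text \<open>The sum of \<open>f n x y\<close> over all \<open>n + x + y = L\<close> with \<open>y - x = a\<close>.\<close>

definition tri_sum :: "(int \<Rightarrow> int \<Rightarrow> int \<Rightarrow> 'a::comm_monoid_add) \<Rightarrow> int \<Rightarrow> int \<Rightarrow> 'a" where
  "tri_sum f L a = (\<Sum>x\<in>{0..L}. f (L - 2 * x - a) x (x + a))"

lemma tri_sum_range:
  assumes "tri_supported f" "c \<le> 0" "L \<le> d"
  shows "tri_sum f L a = (\<Sum>x\<in>{c..d}. f (L - 2 * x - a) x (x + a))"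
  unfolding tri_sum_def
proof (rule sum.mono_neutral_left)
  show "\<forall>x\<in>{c..d} - {0..L}. f (L - 2 * x - a) x (x + a) = 0"
    \<comment> \<open>For \<open>x > L\<close> the indices \<open>L - 2 * x - a\<close> and
      \<open>x + a\<close> add up to \<open>L - x < 0\<close>, so one of them is negative.\<close>
    using assms(1) unfolding tri_supported_def by fastforce
qed (use assms in auto)

lemma tri_sum_shift_n:
  assumes "tri_supported f"
  shows "tri_sum (\<lambda>n x y. f (n - 1) x y) L a = tri_sum f (L - 1) a"
proof -
  have "tri_sum f (L - 1) a = (\<Sum>x\<in>{0..L}. f (L - 1 - 2 * x - a) x (x + a))"
    by (rule tri_sum_range[OF assms]) auto
  then show ?thesis
    unfolding tri_sum_def by (auto simp: algebra_simps intro!: sum.cong)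
qed

lemma tri_sum_shift_y:
  assumes "tri_supported f"
  shows "tri_sum (\<lambda>n x y. f n x (y - 1)) L a = tri_sum f (L - 1) (a - 1)"
proof -
  have "tri_sum f (L - 1) (a - 1) = (\<Sum>x\<in>{0..L}. f (L - 1 - 2 * x - (a - 1)) x (x + (a - 1)))"
    by (rule tri_sum_range[OF assms]) auto
  then show ?thesis
    unfolding tri_sum_def by (auto simp: algebra_simps intro!: sum.cong)
qed

lemma tri_sum_swap:
  assumes "tri_supported f"
  shows "tri_sum (\<lambda>n x y. f n y x) L (- a) = tri_sum f L a"
proof -
  have "tri_supported (\<lambda>n x y. f n y x)"
    using assms by (auto simp: tri_supported_def)
  \<comment> \<open>The interval is chosen so that it and its translate by \<open>- a\<close> both
    contain \<open>{0..L}\<close>.\<close>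
  then have "tri_sum (\<lambda>n x y. f n y x) L (- a) =
      (\<Sum>x\<in>{min 0 a..max L (L + a)}. f (L - 2 * x + a) (x - a) x)"
    by (subst tri_sum_range[where c = "min 0 a" and d = "max L (L + a)"]) auto
  also have "\<dots> = (\<Sum>x\<in>{min 0 a - a..max L (L + a) - a}. f (L - 2 * x - a) x (x + a))"
    by (rule sum.reindex_bij_witness[of _ "\<lambda>x. x + a" "\<lambda>x. x - a"])
       (auto simp: algebra_simps)
  also have "\<dots> = tri_sum f L a"
    by (rule tri_sum_range[OF assms, symmetric]) auto
  finally show ?thesis .
qed

lemma tri_sum_shift_x:
  assumes "tri_supported f"
  shows "tri_sum (\<lambda>n x y. f n (x - 1) y) L a = tri_sum f (L - 1) (a + 1)"
proof -
  have "tri_supported (\<lambda>n x y. f n (x - 1) y)" "tri_supported (\<lambda>n x y. f n y x)"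
    using assms by (fastforce simp: tri_supported_def)+
  then show ?thesis
    using tri_sum_swap[of "\<lambda>n x y. f n (x - 1) y" L a] tri_sum_swap[OF assms, of "L - 1" "a + 1"]
      tri_sum_shift_y[of "\<lambda>n x y. f n y x" L "- a"]
    by (simp add: minus_diff_commute)
qed

lemma tri_sum_neg: "L < 0 \<Longrightarrow> tri_sum f L a = 0"
  by (simp add: tri_sum_def)

definition rtri_term :: "int \<Rightarrow> int \<Rightarrow> int \<Rightarrow> int \<Rightarrow> int \<Rightarrow> int \<Rightarrow> rat poly fract" where
  "rtri_term N A B n x y =
     q powi (n * (n + x + y) + 2 * x * y) * qbinom N n * qbinom (A + x) x * qbinom (B + y) y"

text \<open>The upper parameters are independent so that Pascal's rule can act on one factor at a
  time; \<open>rtrinom\<close> takes \<open>N = M\<close>, \<open>A = M + b\<close>,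
  \<open>B = M - b\<close>.\<close>

definition rtri :: "int \<Rightarrow> int \<Rightarrow> int \<Rightarrow> int \<Rightarrow> int \<Rightarrow> rat poly fract" where
  "rtri N A B = tri_sum (rtri_term N A B)"

lemma tri_supported_rtri_term: "tri_supported (rtri_term N A B)"
  unfolding tri_supported_def rtri_term_def by (auto dest: qbinom_nonzeroD)

lemma rtri_neg: "L < 0 \<Longrightarrow> rtri N A B L a = 0"
  by (simp add: rtri_def tri_sum_neg)

lemma rtri_eq_0:
  assumes "N < 0 \<or> A < 0 \<or> B < 0"
  shows "rtri N A B L a = 0"
  using assms unfolding rtri_def tri_sum_def rtri_term_def
  by (intro sum.neutral) (auto simp: qbinom_gt dest!: qbinom_nonzeroD)

lemma rtri_swap: "rtri N A B L a = rtri N B A L (- a)"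
proof -
  have "rtri_term N B A = (\<lambda>n x y. rtri_term N A B n y x)"
    by (auto simp: rtri_term_def fun_eq_iff algebra_simps)
  then show ?thesis
    using tri_sum_swap[OF tri_supported_rtri_term, of N A B L a] by (simp add: rtri_def)
qed

text \<open>
  The excluded boundary case \<open>A = 0\<close>, \<open>a \<ge> 0\<close> comes from the convention \<open>[-1; 0] = 0\<close>, for which
  Pascal's rule fails at \<open>[0; 0]\<close>.
\<close>

lemma rtri_contract_A:
  assumes "A \<noteq> 0 \<or> a < 0"
  shows "rtri N A B L a = rtri N (A - 1) B L a + q powi (A + L + a) * rtri N A B (L - 1) (a + 1)"
proof -
  have *: "rtri_term N A B n x y = rtri_term N (A - 1) B n x y
      + q powi (A + L + a) * rtri_term N A B n (x - 1) y"
    if nxy: "n = L - 2 * x - a" "y = x + a" for n x y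
  proof (cases "A = 0 \<and> x = 0")
    case True
    with assms that show ?thesis by (auto simp: rtri_term_def qbinom_neg)
  next
    case False
    \<comment> \<open>Lowering \<open>x\<close> lowers the exponent by
      \<open>n + 2 * y = L + a\<close>, which is constant along the sum.\<close>
    have "q powi (n * (n + x + y) + 2 * x * y) * q powi A =
        q powi (A + L + a) * q powi (n * (n + (x - 1) + y) + 2 * (x - 1) * y)"
      unfolding q_powi_add[symmetric] by (simp add: nxy algebra_simps)
    moreover have "qbinom (A + x) x = qbinom (A - 1 + x) x + q powi A * qbinom (A + (x - 1)) (x - 1)"
      using qbinom_pascal[of "A + x" x] False by (auto simp: algebra_simps)
    ultimately show ?thesis
      unfolding rtri_term_def by (simp add: algebra_simps)
  qed
  have "rtri N A B L a = rtri N (A - 1) B L a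
      + q powi (A + L + a) * tri_sum (\<lambda>n x y. rtri_term N A B n (x - 1) y) L a"
    unfolding rtri_def tri_sum_def sum_distrib_left sum.distrib[symmetric]
    by (intro sum.cong *) auto
  then show ?thesis
    by (simp add: tri_sum_shift_x[OF tri_supported_rtri_term] rtri_def)
qed

lemma rtri_contract_B:
  assumes "B \<noteq> 0 \<or> a > 0"
  shows "rtri N A B L a = rtri N A (B - 1) L a + q powi (B + L - a) * rtri N A B (L - 1) (a - 1)"
  using rtri_contract_A[of B "- a" N A L] assms
  by (simp add: rtri_swap[of N A B] rtri_swap[of N A "B - 1"] algebra_simps)

lemma rtri_contract_N:
  assumes "N \<noteq> 0"
  shows "rtri N A B L a = rtri (N - 1) A B L a + q powi (N + L - 1) * rtri (N - 1) A B (L - 1) a"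
proof -
  have *: "rtri_term N A B n x y = rtri_term (N - 1) A B n x y
      + q powi (N + L - 1) * rtri_term (N - 1) A B (n - 1) x y"
    if nxy: "n = L - 2 * x - a" "y = x + a" for n x y
  proof -
    have "q powi (n * (n + x + y) + 2 * x * y) * q powi (N - n) =
        q powi (N + L - 1) * q powi ((n - 1) * ((n - 1) + x + y) + 2 * x * y)"
      unfolding q_powi_add[symmetric] by (simp add: nxy algebra_simps)
    moreover have "qbinom N n = qbinom (N - 1) n + q powi (N - n) * qbinom (N - 1) (n - 1)"
      using qbinom_pascal[of N n] assms by auto
    ultimately show ?thesis
      unfolding rtri_term_def by (simp add: algebra_simps)
  qed
  have "rtri N A B L a = rtri (N - 1) A B L a
      + q powi (N + L - 1) * tri_sum (\<lambda>n x y. rtri_term (N - 1) A B (n - 1) x y) L a"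
    unfolding rtri_def tri_sum_def sum_distrib_left sum.distrib[symmetric]
    by (intro sum.cong *) auto
  then show ?thesis
    by (simp add: tri_sum_shift_n[OF tri_supported_rtri_term] rtri_def)
qed

section \<open>Contiguous relations for \<open>T(L,M;a,b)\<close>\<close>

definition rtrinom :: "int \<Rightarrow> int \<Rightarrow> int \<Rightarrow> int \<Rightarrow> rat poly fract" where
  "rtrinom L M a b = rtri M (M + b) (M - b) L a"

lemma rtrinom_neg: "L < 0 \<Longrightarrow> rtrinom L M a b = 0"
  by (simp add: rtrinom_def rtri_neg)

lemma rtrinom_eq_0: "M < \<bar>b\<bar> \<Longrightarrow> rtrinom L M a b = 0"
  unfolding rtrinom_def by (rule rtri_eq_0) auto

lemma rtrinom_minus: "rtrinom L M (- a) (- b) = rtrinom L M a b"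
  using rtri_swap[of M "M + b" "M - b" L a] by (simp add: rtrinom_def)

text \<open>The powers of \<open>q\<close> involve \<open>l\<close> and \<open>m\<close> only
  through \<open>l + m\<close>, so they leave sums over an antidiagonal; this drives the passage
  from \<open>b - 1\<close> to \<open>b\<close>. Contractions link every term to the intermediate
  parameters \<open>A = m + b - 1\<close>, \<open>B = m - b\<close>.\<close>

lemma rtrinom_lower_b:
  assumes "b \<ge> 1" "a \<ge> 0" "m \<ge> 0"
  shows "rtrinom l m a b - q powi (m + l + a + b) * rtrinom (l - 1) m (a + 1) b
      + q powi (a + b) * rtrinom l (m - 1) (a + 1) b =
    q powi (a + b) * rtrinom l m (a + 1) (b - 1) - q powi (m + l) * rtrinom (l - 1) m a (b - 1)
      + rtrinom l (m - 1) a (b - 1)"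
proof -
  have exps: "q powi (a + b) * q powi (m - b + 1 + l - (a + 1)) = q powi (m + l)"
    "q powi (a + b) * q powi (m - b + l - (a + 1)) = q powi (m + l - 1)"
    "q powi (a + b) * q powi (m + l - 1) = q powi (m + b - 1 + l + a)"
    by (simp_all add: q_powi_add[symmetric] algebra_simps)
  have raise: "rtrinom l m (a + 1) (b - 1) = rtri m (m + b - 1) (m - b) l (a + 1)
      + q powi (m - b + 1 + l - (a + 1)) * rtrinom (l - 1) m a (b - 1)"
    using rtri_contract_B[of "m - b + 1" "a + 1" m "m + b - 1" l] assms
    by (simp add: rtrinom_def algebra_simps)
  show ?thesis
  \<comment> \<open>\<open>rtri_contract_N\<close> requires \<open>m \<noteq> 0\<close>; at
    \<open>m = 0\<close> the parameter \<open>B = - b\<close> is negative and the contracted sum is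
    zero.\<close>
  proof (cases "m = 0")
    case True
    have "rtri m (m + b - 1) (m - b) l (a + 1) = 0"
      by (rule rtri_eq_0) (use True assms in auto)
    then have "q powi (a + b) * rtrinom l m (a + 1) (b - 1) = q powi (m + l) * rtrinom (l - 1) m a (b - 1)"
      using raise exps(1) by (simp add: mult.assoc[symmetric])
    then show ?thesis
      using True assms by (simp add: rtrinom_eq_0)
  next
    case False
    have 1: "rtrinom l m a b = rtri m (m + b - 1) (m - b) l a
        + q powi (m + l + a + b) * rtrinom (l - 1) m (a + 1) b"
      using rtri_contract_A[of "m + b" a m "m - b" l] assms
      by (simp add: rtrinom_def algebra_simps)
    have 2: "rtri (m - 1) (m + b - 1) (m - b) l (a + 1) = rtrinom l (m - 1) (a + 1) b
        + q powi (m - b + l - (a + 1)) * rtri (m - 1) (m + b - 1) (m - b) (l - 1) a"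
      using rtri_contract_B[of "m - b" "a + 1" "m - 1" "m + b - 1" l] assms
      by (simp add: rtrinom_def algebra_simps)
    have 3: "rtri (m - 1) (m + b - 1) (m - b) l a = rtrinom l (m - 1) a (b - 1)
        + q powi (m + b - 1 + l + a) * rtri (m - 1) (m + b - 1) (m - b) (l - 1) (a + 1)"
      using rtri_contract_A[of "m + b - 1" a "m - 1" "m - b" l] assms False
      by (simp add: rtrinom_def algebra_simps)
    have 4: "rtri m (m + b - 1) (m - b) l c = rtri (m - 1) (m + b - 1) (m - b) l c
        + q powi (m + l - 1) * rtri (m - 1) (m + b - 1) (m - b) (l - 1) c" for c
      using False by (rule rtri_contract_N)
    show ?thesis
      using raise exps 1 2 3 4[of a] 4[of "a + 1"] by algebra
  qed
qed

text \<open>Contracting \<open>A\<close> on the left and \<open>B\<close> on the right yields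
  \<open>rtri m (m + b - 1) (m - b) l c\<close> in both cases.\<close>

lemma rtrinom_contract:
  assumes "b \<ge> 1" "c \<ge> b" "m \<ge> 0"
  shows "rtrinom l m c b - q powi (m + b + l + c) * rtrinom (l - 1) m (c + 1) b =
    rtrinom l m c (b - 1) - q powi (m - b + 1 + l - c) * rtrinom (l - 1) m (c - 1) (b - 1)"
  using rtri_contract_A[of "m + b" c m "m - b" l]
    rtri_contract_B[of "m - b + 1" c m "m + b - 1" l] assms
  by (simp add: rtrinom_def algebra_simps)

text \<open>Only \<open>n = 0\<close>, \<open>x = y = L div 2\<close> contributes, with value
  q^(L^2/2) for even \<open>L\<close>. This settles the point \<open>A = B = a = 0\<close>, which
  neither contraction in \<open>A\<close> nor in \<open>B\<close> reaches.\<close>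

lemma rtrinom_centre_rec:
  assumes "L \<ge> 1"
  shows "rtrinom L 0 0 0 = q powi (2 * L - 2) * rtrinom (L - 2) 0 0 0"
proof -
  have *: "rtrinom L 0 0 0 = (if even L \<and> 0 \<le> L then q powi (L * (L div 2)) else 0)" for L
  proof -
    have "rtri_term 0 0 0 (L - 2 * x - 0) x (x + 0) =
        (if x = L div 2 then if even L then q powi (L * (L div 2)) else 0 else 0)"
      if "x \<in> {0..L}" for x
      using that by (auto simp: rtri_term_def qbinom_def)
    then have "rtrinom L 0 0 0 =
        (\<Sum>x\<in>{0..L}. if x = L div 2 then if even L then q powi (L * (L div 2)) else 0 else 0)"
      unfolding rtrinom_def rtri_def tri_sum_def by (intro sum.cong) auto
    then show ?thesis by (auto simp: sum.delta)
  qed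
  show ?thesis
  proof (cases "even L")
    case True
    then obtain k where "L = 2 * k" by auto
    then show ?thesis
      using assms unfolding * by (auto simp: q_powi_add[symmetric] algebra_simps)
  qed (simp add: *)
qed

text \<open>Again the coefficients depend on \<open>l + m\<close> only, so the recurrence passes
  through both summation operators. For \<open>m > 0\<close>, contract \<open>A\<close>, then
  \<open>B\<close>, then \<open>N\<close>, and remove the mixed term by contracting \<open>A\<close>
  once more at \<open>(l - 1, a - 1)\<close>.\<close>

lemma rtrinom_rec_b0:
  assumes "l + m = L" "L \<ge> 1" "m \<ge> 0"
  shows "rtrinom l m a 0 =
    q powi L * (q powi a * rtrinom (l - 1) m (a + 1) 0 + q powi (- a) * rtrinom (l - 1) m (a - 1) 0)
    - q powi (2 * L - 2) * rtrinom (l - 2) m a 0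
    + rtrinom l (m - 1) a 0 + q powi (L - 1) * rtrinom (l - 1) (m - 1) a 0"
proof (cases "m = 0")
  case True
  then have [simp]: "l = L" using assms by simp
  have exps: "q powi L * q powi a = q powi (L + a)" "q powi L * q powi (- a) = q powi (L - a)"
    "q powi (L - a) * q powi (L + a - 2) = q powi (2 * L - 2)"
    "q powi (L + a) * q powi (L - a - 2) = q powi (2 * L - 2)"
    by (simp_all add: q_powi_add[symmetric])
  \<comment> \<open>A parameter lowered to -1 kills its term, so the admissible contraction has just
    two terms: in \<open>A\<close> for \<open>a < 0\<close>, in \<open>B\<close> for
    \<open>a > 0\<close>. The case \<open>a = 0\<close> needs
    \<open>rtrinom_centre_rec\<close>.\<close>
  have left: "rtrinom L 0 a 0 = q powi (L + a) * rtrinom (L - 1) 0 (a + 1) 0" if "a < 0" for L a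
    using rtri_contract_A[of 0 a 0 0 L] that by (simp add: rtrinom_def rtri_eq_0)
  have right: "rtrinom L 0 a 0 = q powi (L - a) * rtrinom (L - 1) 0 (a - 1) 0" if "a > 0" for L a
    using rtri_contract_B[of 0 a 0 0 L] that by (simp add: rtrinom_def rtri_eq_0)
  have "rtrinom L 0 a 0 = q powi (L + a) * rtrinom (L - 1) 0 (a + 1) 0
      + q powi (L - a) * rtrinom (L - 1) 0 (a - 1) 0 - q powi (2 * L - 2) * rtrinom (L - 2) 0 a 0"
  proof (cases a "0 :: int" rule: linorder_cases)
    case less
    have "rtrinom (L - 1) 0 (a - 1) 0 = q powi (L + a - 2) * rtrinom (L - 2) 0 a 0"
      using left[of "a - 1" "L - 1"] less by simp
    with left[OF less, of L] exps show ?thesis by algebra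
  next
    case equal
    have "rtrinom (L - 1) 0 (a - 1) 0 = q powi (L + a - 2) * rtrinom (L - 2) 0 a 0"
      using left[of "a - 1" "L - 1"] equal by simp
    moreover have "rtrinom (L - 1) 0 (a + 1) 0 = q powi (L - a - 2) * rtrinom (L - 2) 0 a 0"
      using right[of "a + 1" "L - 1"] equal by simp
    moreover have "rtrinom L 0 a 0 = q powi (2 * L - 2) * rtrinom (L - 2) 0 a 0"
      using rtrinom_centre_rec[OF assms(2)] equal by simp
    ultimately show ?thesis using exps by algebra
  next
    case greater
    have "rtrinom (L - 1) 0 (a + 1) 0 = q powi (L - a - 2) * rtrinom (L - 2) 0 a 0"
      using right[of "a + 1" "L - 1"] greater by simp
    with right[OF greater, of L] exps show ?thesis by algebra
  qed
  then show ?thesis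
    using True by (simp add: rtrinom_eq_0 distrib_left mult.assoc[symmetric] exps(1,2))
next
  case False
  have 1: "rtrinom l m a 0 = rtri m (m - 1) m l a + q powi (L + a) * rtrinom (l - 1) m (a + 1) 0"
    using rtri_contract_A[of m a m m l] False assms(1) by (simp add: rtrinom_def algebra_simps)
  have 2: "rtrinom (l - 1) m (a - 1) 0 = rtri m (m - 1) m (l - 1) (a - 1)
      + q powi (L + a - 2) * rtrinom (l - 2) m a 0"
    using rtri_contract_A[of m "a - 1" m m "l - 1"] False assms(1)
    by (simp add: rtrinom_def algebra_simps)
  have 3: "rtri m (m - 1) m l a = rtri m (m - 1) (m - 1) l a
      + q powi (L - a) * rtri m (m - 1) m (l - 1) (a - 1)"
    using rtri_contract_B[of m a m "m - 1" l] False assms(1) by (simp add: algebra_simps)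
  have 4: "rtri m (m - 1) (m - 1) l a = rtrinom l (m - 1) a 0
      + q powi (L - 1) * rtrinom (l - 1) (m - 1) a 0"
    using rtri_contract_N[of m "m - 1" "m - 1" l a] False assms(1)
    by (simp add: rtrinom_def algebra_simps)
  have e: "q powi L * q powi a = q powi (L + a)" "q powi L * q powi (- a) = q powi (L - a)"
    "q powi (L - a) * q powi (L + a - 2) = q powi (2 * L - 2)"
    by (simp_all add: q_powi_add[symmetric])
  have "rtrinom l m a 0 = q powi (L + a) * rtrinom (l - 1) m (a + 1) 0
      + q powi (L - a) * rtrinom (l - 1) m (a - 1) 0 - q powi (2 * L - 2) * rtrinom (l - 2) m a 0
      + rtrinom l (m - 1) a 0 + q powi (L - 1) * rtrinom (l - 1) (m - 1) a 0"
    unfolding 1 2 3 4 using e(3) by (simp add: algebra_simps)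
  then show ?thesis
    by (simp add: distrib_left mult.assoc[symmetric] e(1,2))
qed

lemma rtrinom_L0: "rtrinom 0 M a b = of_bool (a = 0 \<and> \<bar>b\<bar> \<le> M)"
  by (auto simp: rtrinom_def rtri_def tri_sum_def rtri_term_def qbinom_def)

section \<open>Summation formulas\<close>

text \<open>The operator of the first summation formula, with \<open>m = L - l\<close>; it acts on
  functions on the antidiagonal \<open>l + m = L\<close>.\<close>

definition burge :: "int \<Rightarrow> int \<Rightarrow> (int \<Rightarrow> int \<Rightarrow> rat poly fract) \<Rightarrow> rat poly fract" where
  "burge L M h = (\<Sum>m\<in>{0..L}. q powi (L * m) * qbinom (L + M - m) L * h (L - m) m)"

lemma burge_neg: "L < 0 \<Longrightarrow> burge L M h = 0"
  by (simp add: burge_def)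

lemma burge_L0: "0 \<le> M \<Longrightarrow> burge 0 M h = h 0 0"
  by (simp add: burge_def)

lemma burge_M0:
  assumes "0 \<le> L"
  shows "burge L 0 h = h L 0"
proof -
  have "burge L 0 h = (\<Sum>m\<in>{0..L}. if m = 0 then h L 0 else 0)"
    unfolding burge_def by (intro sum.cong) (auto simp: qbinom_gt qbinom_same)
  with assms show ?thesis by simp
qed

lemma burge_cong:
  "(\<And>l m. l + m = L \<Longrightarrow> 0 \<le> l \<Longrightarrow> 0 \<le> m \<Longrightarrow> h l m = h' l m) \<Longrightarrow> burge L M h = burge L M h'"
  unfolding burge_def by (intro sum.cong) auto

lemma burge_add: "burge L M (\<lambda>l m. h l m + h' l m) = burge L M h + burge L M h'"
  by (simp add: burge_def algebra_simps sum.distrib)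

lemma burge_diff: "burge L M (\<lambda>l m. h l m - h' l m) = burge L M h - burge L M h'"
  by (simp add: burge_def algebra_simps sum_subtractf)

lemma burge_cmult: "burge L M (\<lambda>l m. c * h l m) = c * burge L M h"
  by (simp add: burge_def algebra_simps sum_distrib_left)

lemma sum_drop_first:
  fixes f :: "int \<Rightarrow> 'a::comm_monoid_add"
  assumes "f 0 = 0"
  shows "(\<Sum>m\<in>{0..L}. f m) = (\<Sum>m\<in>{0..L - 1}. f (m + 1))"
proof -
  have "(\<Sum>m\<in>{0..L}. f m) = (\<Sum>m\<in>{1..L}. f m)"
  proof (rule sum.mono_neutral_right)
    show "\<forall>m\<in>{0..L} - {1..L}. f m = 0"
    proof
      fix m assume "m \<in> {0..L} - {1..L}"
      then have "m = 0" by auto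
      with assms show "f m = 0" by simp
    qed
  qed auto
  also have "\<dots> = (\<Sum>m\<in>{0..L - 1}. f (m + 1))"
    by (rule sum.reindex_bij_witness[of _ "\<lambda>m. m + 1" "\<lambda>m. m - 1"]) auto
  finally show ?thesis .
qed

lemma sum_drop_last:
  fixes f :: "int \<Rightarrow> 'a::comm_monoid_add"
  assumes "f L = 0"
  shows "(\<Sum>m\<in>{0..L}. f m) = (\<Sum>m\<in>{0..L - 1}. f m)"
proof (rule sum.mono_neutral_right)
  show "\<forall>m\<in>{0..L} - {0..L - 1}. f m = 0"
  proof
    fix m assume "m \<in> {0..L} - {0..L - 1}"
    then have "m = L" by auto
    with assms show "f m = 0" by simp
  qed
qed auto

text \<open>After shifting, both sums run over the antidiagonal of \<open>L - 1\<close>, and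
  Pascal's rule for \<open>qbinom (L + M - m) L\<close> leaves the kernel of
  \<open>burge (L - 1) M\<close>.\<close>

lemma burge_lower_L:
  assumes "\<And>l m. l < 0 \<or> m < 0 \<Longrightarrow> h l m = 0"
  shows "burge L M (\<lambda>l m. h l (m - 1) - q powi L * h (l - 1) m) = - (q powi (L + M)) * burge (L - 1) M h"
proof (cases "L \<ge> 1")
  case True
  have "burge L M (\<lambda>l m. h l (m - 1)) =
      (\<Sum>m\<in>{0..L - 1}. q powi (L * (m + 1)) * qbinom (L + M - (m + 1)) L * h (L - (m + 1)) m)"
    unfolding burge_def by (subst sum_drop_first) (simp_all add: assms)
  moreover have "burge L M (\<lambda>l m. h (l - 1) m) =
      (\<Sum>m\<in>{0..L - 1}. q powi (L * m) * qbinom (L + M - m) L * h (L - m - 1) m)"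
    unfolding burge_def by (subst sum_drop_last) (simp_all add: assms)
  moreover have "q powi (L * (m + 1)) * qbinom (L + M - (m + 1)) L * h (L - (m + 1)) m
      - q powi L * (q powi (L * m) * qbinom (L + M - m) L * h (L - m - 1) m) =
      - (q powi (L + M)) * (q powi ((L - 1) * m) * qbinom (L - 1 + M - m) (L - 1) * h (L - 1 - m) m)" for m
  proof -
    let ?B = "qbinom (L + M - (m + 1)) L" and ?C = "qbinom (L - 1 + M - m) (L - 1)"
      and ?h = "h (L - 1 - m) m"
    have pascal: "qbinom (L + M - m) L = ?B + q powi (M - m) * ?C"
      using qbinom_pascal[of "L + M - m" L] True by (simp add: algebra_simps)
    have exps: "q powi (L * (m + 1)) = q powi L * q powi (L * m)"
      "q powi L * q powi (L * m) * q powi (M - m) = q powi (L + M) * q powi ((L - 1) * m)"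
      by (simp_all add: q_powi_add[symmetric] algebra_simps)
    have hs: "h (L - (m + 1)) m = ?h" "h (L - m - 1) m = ?h"
      by (simp_all add: algebra_simps)
    have "q powi L * q powi (L * m) * ?B * ?h - q powi L * (q powi (L * m) * (?B + q powi (M - m) * ?C) * ?h) =
        - (q powi L * q powi (L * m) * q powi (M - m)) * (?C * ?h)"
      by (simp add: algebra_simps)
    then show ?thesis
      unfolding pascal exps hs by (simp add: mult.assoc)
  qed
  ultimately show ?thesis
    by (simp add: burge_diff burge_cmult sum_distrib_left sum_subtractf[symmetric])
       (simp add: burge_def sum_distrib_left sum_negf)
next
  case False
  then consider "L < 0" | "L = 0" by linarith
  then show ?thesis
    by cases (auto simp: burge_def assms)
qed

text \<open>Pascal's rule turns the difference in \<open>M\<close> into the kernel \<open>w\<close>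
  of \<open>burge (L - 1) M\<close>, still summed over \<open>l + m = L\<close>. The splitting of
  \<open>h\<close> brings both parts down to \<open>l + m = L - 1\<close>; shifting \<open>m\<close>
  in the second part changes \<open>M\<close> to \<open>M - 1\<close>.\<close>

lemma burge_lower_M:
  assumes "L \<ge> 1"
    and h: "\<And>l m. l + m = L \<Longrightarrow> 0 \<le> l \<Longrightarrow> 0 \<le> m \<Longrightarrow> h l m = h1 (l - 1) m + h2 l (m - 1)"
    and h1: "\<And>l m. l < 0 \<Longrightarrow> h1 l m = 0"
    and h2: "\<And>l m. m < 0 \<Longrightarrow> h2 l m = 0"
  shows "burge L M h - burge L (M - 1) h =
    q powi M * (burge (L - 1) M h1 + q powi (L - 1) * burge (L - 1) (M - 1) h2)"
proof -
  define w where "w m = q powi ((L - 1) * m) * qbinom (L - 1 + M - m) (L - 1)" for m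
  have "q powi (L * m) * qbinom (L + M - m) L * c - q powi (L * m) * qbinom (L + (M - 1) - m) L * c =
      q powi M * (w m * c)" for m c
  proof -
    have pascal: "qbinom (L + M - m) L = qbinom (L + (M - 1) - m) L
        + q powi (M - m) * qbinom (L - 1 + M - m) (L - 1)"
      using qbinom_pascal[of "L + M - m" L] \<open>L \<ge> 1\<close> by (simp add: algebra_simps)
    have "q powi (L * m) * q powi (M - m) = q powi M * q powi ((L - 1) * m)"
      by (simp add: q_powi_add[symmetric] algebra_simps)
    then have "q powi (L * m) * q powi (M - m) * d = q powi M * q powi ((L - 1) * m) * d" for d
      by simp
    then show ?thesis
      unfolding pascal w_def by (simp add: distrib_left distrib_right mult.assoc)
  qed
  then have "burge L M h - burge L (M - 1) h = q powi M * (\<Sum>m\<in>{0..L}. w m * h (L - m) m)"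
    unfolding burge_def sum_subtractf[symmetric] sum_distrib_left by simp
  also have "(\<Sum>m\<in>{0..L}. w m * h (L - m) m) =
      (\<Sum>m\<in>{0..L}. w m * h1 (L - m - 1) m) + (\<Sum>m\<in>{0..L}. w m * h2 (L - m) (m - 1))"
    unfolding sum.distrib[symmetric] by (intro sum.cong) (auto simp: h algebra_simps)
  also have "(\<Sum>m\<in>{0..L}. w m * h1 (L - m - 1) m) = burge (L - 1) M h1"
    by (subst sum_drop_last) (simp_all add: h1 w_def burge_def algebra_simps)
  also have "(\<Sum>m\<in>{0..L}. w m * h2 (L - m) (m - 1)) = q powi (L - 1) * burge (L - 1) (M - 1) h2"
  proof -
    have "L - 1 + M - (m + 1) = L - 1 + (M - 1) - m" "(L - 1) * (m + 1) = (L - 1) + (L - 1) * m"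
      "L - (m + 1) = L - 1 - m" for m
      by (simp_all add: distrib_left)
    then have *: "w (m + 1) * h2 (L - (m + 1)) m = q powi (L - 1) *
        (q powi ((L - 1) * m) * qbinom (L - 1 + (M - 1) - m) (L - 1) * h2 (L - 1 - m) m)" for m
      by (simp only: w_def q_powi_add mult.assoc)
    have "(\<Sum>m\<in>{0..L}. w m * h2 (L - m) (m - 1)) = (\<Sum>m\<in>{0..L - 1}. w (m + 1) * h2 (L - (m + 1)) m)"
      by (subst sum_drop_first) (simp_all add: h2)
    then show ?thesis
      by (simp only: * burge_def sum_distrib_left)
  qed
  finally show ?thesis .
qed

text \<open>Applied to \<open>rtrinom_rec_b0\<close> on \<open>l + m = L\<close>,
  \<open>burge\<close> produces the same recurrence at \<open>(L, M)\<close>, now with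
  \<open>L + M\<close> in its coefficients; hence induction on \<open>L + M\<close>.\<close>

lemma burge_rtrinom_b0:
  assumes "M \<ge> 0"
  shows "burge L M (\<lambda>l m. rtrinom l m a 0) = rtrinom L M a 0"
  using assms
proof (induction "nat (L + M)" arbitrary: L M a rule: less_induct)
  case less
  consider "L < 0" | "L = 0" | "L \<ge> 1" "M = 0" | "L \<ge> 1" "M \<ge> 1"
    using less.prems by linarith
  then show ?case
  proof cases
    case 4
    \<comment> \<open>All terms with lowered \<open>l\<close>; the last two form the combination
      that \<open>burge_lower_L\<close> evaluates at \<open>L - 1\<close>.\<close>
    define h1 where "h1 l m =
        q powi L * (q powi a * rtrinom l m (a + 1) 0 + q powi (- a) * rtrinom l m (a - 1) 0)
        + q powi (L - 1) * (rtrinom l (m - 1) a 0 - q powi (L - 1) * rtrinom (l - 1) m a 0)" for l m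
    have IH: "burge L' M' (\<lambda>l m. rtrinom l m a' 0) = rtrinom L' M' a' 0"
      if "L' + M' < L + M" "M' \<ge> 0" for L' M' a'
      using that less.hyps[of L' M' a'] 4 by (auto simp: nat_less_iff)
    have e: "q powi (L - 1) * q powi (L - 1) = q powi (2 * L - 2)"
      by (simp add: q_powi_add[symmetric])
    have "burge L M (\<lambda>l m. rtrinom l m a 0) - burge L (M - 1) (\<lambda>l m. rtrinom l m a 0) =
        q powi M * (burge (L - 1) M h1 + q powi (L - 1) * burge (L - 1) (M - 1) (\<lambda>l m. rtrinom l m a 0))"
    proof (rule burge_lower_M)
      show "rtrinom l m a 0 = h1 (l - 1) m + rtrinom l (m - 1) a 0"
        if "l + m = L" "0 \<le> l" "0 \<le> m" for l m
        using rtrinom_rec_b0[OF that(1), of a] that 4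
        unfolding h1_def e[symmetric] by (simp add: right_diff_distrib mult.assoc)
    qed (use 4 in \<open>auto simp: h1_def rtrinom_neg rtrinom_eq_0\<close>)
    then have "burge L M (\<lambda>l m. rtrinom l m a 0) = rtrinom L (M - 1) a 0
        + q powi M * (burge (L - 1) M h1 + q powi (L - 1) * rtrinom (L - 1) (M - 1) a 0)"
      using 4 by (simp add: IH diff_eq_eq add.commute)
    also have "burge (L - 1) M h1 =
        q powi L * (q powi a * rtrinom (L - 1) M (a + 1) 0 + q powi (- a) * rtrinom (L - 1) M (a - 1) 0)
        - q powi (L - 1) * (q powi (L - 1 + M) * rtrinom (L - 2) M a 0)"
      unfolding h1_def burge_add burge_cmult
      by (subst burge_lower_L) (use 4 in \<open>auto simp: IH rtrinom_neg rtrinom_eq_0\<close>)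
    also have "rtrinom L (M - 1) a 0 + q powi M * (\<dots> + q powi (L - 1) * rtrinom (L - 1) (M - 1) a 0) =
        q powi L * q powi M * (q powi a * rtrinom (L - 1) M (a + 1) 0
          + q powi (- a) * rtrinom (L - 1) M (a - 1) 0)
        - q powi M * q powi (L - 1) * q powi (L - 1 + M) * rtrinom (L - 2) M a 0
        + rtrinom L (M - 1) a 0 + q powi M * q powi (L - 1) * rtrinom (L - 1) (M - 1) a 0"
      by (simp add: algebra_simps)
    also have "q powi L * q powi M = q powi (L + M)"
      by (simp add: q_powi_add)
    also have "q powi M * q powi (L - 1) = q powi (L + M - 1)"
      by (simp add: q_powi_add[symmetric] algebra_simps)
    also have "q powi (L + M - 1) * q powi (L - 1 + M) = q powi (2 * (L + M) - 2)"
      by (simp add: q_powi_add[symmetric] algebra_simps)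
    also have "q powi (L + M) * (q powi a * rtrinom (L - 1) M (a + 1) 0
          + q powi (- a) * rtrinom (L - 1) M (a - 1) 0)
        - q powi (2 * (L + M) - 2) * rtrinom (L - 2) M a 0
        + rtrinom L (M - 1) a 0 + q powi (L + M - 1) * rtrinom (L - 1) (M - 1) a 0 = rtrinom L M a 0"
      by (rule rtrinom_rec_b0[symmetric]) (use 4 in auto)
    finally show ?thesis .
  qed (use less.prems in \<open>auto simp: burge_neg rtrinom_neg burge_L0 rtrinom_L0 burge_M0\<close>)
qed

text \<open>Outer induction on \<open>b\<close>, inner on \<open>L\<close>: under
  \<open>burge\<close>, \<open>rtrinom_lower_b\<close> leads to \<open>b - 1\<close> and to
  \<open>(L - 1, a + 1)\<close>, and \<open>rtrinom_contract\<close> gives the matching relation for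
  the right-hand side.\<close>

lemma burge_rtrinom:
  assumes "M \<ge> 0" "a \<ge> 0"
  shows "burge L M (\<lambda>l m. rtrinom l m a (int b)) =
    q powi (int b * (a + int b)) * rtrinom L M (a + int b) (int b)"
  using assms
proof (induction b arbitrary: L M a)
  case 0
  then show ?case by (simp add: burge_rtrinom_b0)
next
  case (Suc b)
  define c where "c = int (Suc b)"
  have c: "int b = c - 1" "c \<ge> 1" by (auto simp: c_def)
  have prev: "burge L M (\<lambda>l m. rtrinom l m a (c - 1)) =
      q powi ((c - 1) * (a + c - 1)) * rtrinom L M (a + c - 1) (c - 1)"
    if "a \<ge> 0" for L a
    using Suc.IH[OF \<open>M \<ge> 0\<close> that, of L] by (simp add: c algebra_simps)
  have "burge L M (\<lambda>l m. rtrinom l m a c) = q powi (c * (a + c)) * rtrinom L M (a + c) c"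
    using \<open>a \<ge> 0\<close>
  proof (induction "nat L" arbitrary: L a rule: less_induct)
    case less
    consider "L < 0" | "L = 0" | "L \<ge> 1" by linarith
    then show ?case
    proof cases
      case 3
      have IH: "burge (L - 1) M (\<lambda>l m. rtrinom l m (a + 1) c) =
          q powi (c * (a + 1 + c)) * rtrinom (L - 1) M (a + 1 + c) c"
        using less.hyps[of "L - 1" "a + 1"] 3 less.prems by simp
      \<comment> \<open>The terms of \<open>rtrinom_lower_b\<close> are grouped into pairs of the
        shape required by \<open>burge_lower_L\<close>.\<close>
      have "burge L M (\<lambda>l m. rtrinom l m a c
            + q powi (a + c) * (rtrinom l (m - 1) (a + 1) c - q powi L * rtrinom (l - 1) m (a + 1) c)) =
          burge L M (\<lambda>l m. q powi (a + c) * rtrinom l m (a + 1) (c - 1)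
            + (rtrinom l (m - 1) a (c - 1) - q powi L * rtrinom (l - 1) m a (c - 1)))"
      proof (rule burge_cong)
        fix l m :: int
        assume "l + m = L" "0 \<le> l" "0 \<le> m"
        moreover have "q powi (L + a + c) = q powi (a + c) * q powi L"
          by (simp add: q_powi_add)
        ultimately show "rtrinom l m a c
            + q powi (a + c) * (rtrinom l (m - 1) (a + 1) c - q powi L * rtrinom (l - 1) m (a + 1) c) =
          q powi (a + c) * rtrinom l m (a + 1) (c - 1)
            + (rtrinom l (m - 1) a (c - 1) - q powi L * rtrinom (l - 1) m a (c - 1))"
          using rtrinom_lower_b[of c a m l] c(2) less.prems
          by (simp add: algebra_simps)
      qed
      then have "burge L M (\<lambda>l m. rtrinom l m a c)
          - q powi (a + c) * (q powi (L + M) * (q powi (c * (a + 1 + c)) * rtrinom (L - 1) M (a + 1 + c) c)) =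
          q powi (a + c) * (q powi ((c - 1) * (a + c)) * rtrinom L M (a + c) (c - 1))
          - q powi (L + M) * (q powi ((c - 1) * (a + c - 1)) * rtrinom (L - 1) M (a + c - 1) (c - 1))"
        unfolding burge_add burge_cmult
        using prev[of "a + 1" L] prev[of a "L - 1"] less.prems IH
        by (subst (asm) (1 2) burge_lower_L) (auto simp: rtrinom_neg rtrinom_eq_0 algebra_simps)
      moreover have "rtrinom L M (a + c) c
          - q powi (M + c + L + (a + c)) * rtrinom (L - 1) M (a + 1 + c) c =
          rtrinom L M (a + c) (c - 1)
          - q powi (M - c + 1 + L - (a + c)) * rtrinom (L - 1) M (a + c - 1) (c - 1)"
        using rtrinom_contract[of c "a + c" M L] less.prems c(2) \<open>M \<ge> 0\<close>
        by (simp add: algebra_simps)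
      moreover have exps: "q powi (a + c) * q powi (L + M) * q powi (c * (a + 1 + c)) =
            q powi (c * (a + c)) * q powi (M + c + L + (a + c))"
          "q powi (a + c) * q powi ((c - 1) * (a + c)) = q powi (c * (a + c))"
          "q powi (L + M) * q powi ((c - 1) * (a + c - 1)) =
            q powi (c * (a + c)) * q powi (M - c + 1 + L - (a + c))"
        by (simp_all add: q_powi_add[symmetric] algebra_simps)
      ultimately show ?thesis
        by (simp only: mult.assoc[symmetric] exps right_diff_distrib[symmetric] diff_eq_eq)
           (simp add: algebra_simps)
    qed (use less.prems \<open>M \<ge> 0\<close> c(2) in \<open>auto simp: burge_neg rtrinom_neg burge_L0 rtrinom_L0\<close>)
  qed
  then show ?case by (simp add: c_def)
qed

section \<open>The trinomial coefficients as sums of multinomials\<close>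

text \<open>Equals \<open>qbinom L k * qbinom (L - k) (k + a)\<close> at
  \<open>n = L - 2 * k - a\<close>, \<open>x = k\<close>, \<open>y = k + a\<close>; its symmetry
  gives one lowering rule per argument.\<close>

definition qmultinom :: "int \<Rightarrow> int \<Rightarrow> int \<Rightarrow> rat poly fract" where
  "qmultinom n x y =
     (if 0 \<le> n \<and> 0 \<le> x \<and> 0 \<le> y
      then qpoch (nat (n + x + y)) / (qpoch (nat n) * qpoch (nat x) * qpoch (nat y)) else 0)"

lemma qmultinom_lower_n:
  "(1 - q powi n) * qmultinom n x y = (1 - q powi (n + x + y)) * qmultinom (n - 1) x y"
proof (cases "1 \<le> n \<and> 0 \<le> x \<and> 0 \<le> y")
  case True
  have "qpoch (nat n) = qpoch (nat (n - 1)) * (1 - q powi n)"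
    using qpoch_nat_rec[of n] True by simp
  moreover from this have "1 - q powi n \<noteq> 0"
    using qpoch_nonzero[of "nat n"] by auto
  moreover have "qpoch (nat (n + x + y)) = qpoch (nat (n - 1 + x + y)) * (1 - q powi (n + x + y))"
    using qpoch_nat_rec[of "n + x + y"] True by (simp add: algebra_simps)
  ultimately show ?thesis
    using True by (simp add: qmultinom_def mult.assoc mult.commute[of "1 - q powi (n + x + y)"])
next
  case False
  then consider "n = 0" | "n < 0 \<or> x < 0 \<or> y < 0" by linarith
  then show ?thesis
    by cases (auto simp: qmultinom_def)
qed

lemma qmultinom_swap: "qmultinom x n y = qmultinom n x y" "qmultinom n y x = qmultinom n x y"
  by (simp_all add: qmultinom_def ac_simps)

lemma qmultinom_lower_x:
  "(1 - q powi x) * qmultinom n x y = (1 - q powi (n + x + y)) * qmultinom n (x - 1) y"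
  using qmultinom_lower_n[of x n y]
  by (simp only: qmultinom_swap(1)[of x] qmultinom_swap(1)[of "x - 1"] add.commute[of x n])

lemma qmultinom_lower_y:
  "(1 - q powi y) * qmultinom n x y = (1 - q powi (n + x + y)) * qmultinom n x (y - 1)"
  using qmultinom_lower_x[of y n x]
  by (simp only: qmultinom_swap(2)[of n y] qmultinom_swap(2)[of n "y - 1"] add.assoc add.commute[of y x])

definition qtri_term :: "int \<Rightarrow> int \<Rightarrow> int \<Rightarrow> rat poly fract" where
  "qtri_term n x y = q powi (x * y) * qmultinom n x y"

lemma tri_supported_qtri_term: "tri_supported qtri_term"
  by (auto simp: tri_supported_def qtri_term_def qmultinom_def split: if_splits)

lemma qtrinom_eq_tri_sum: "qtrinom L a = tri_sum qtri_term L a"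
proof -
  have "qtrinom L a = sum' (\<lambda>k. q powi (k * (k + a)) * qbinom L k * qbinom (L - k) (k + a)) {0..L}"
    unfolding qtrinom2_def by (rule sum.mono_neutral_right') (auto simp: qbinom_gt)
  also have "\<dots> = (\<Sum>k\<in>{0..L}. q powi (k * (k + a)) * qbinom L k * qbinom (L - k) (k + a))"
    by (rule sum.eq_sum) auto
  also have "\<dots> = tri_sum qtri_term L a"
    unfolding tri_sum_def
    by (intro sum.cong) (auto simp: qtri_term_def qmultinom_def qbinom_def algebra_simps)
  finally show ?thesis .
qed

lemma qtrinom_minus: "qtrinom L (- a) = qtrinom L a"
proof -
  have "(\<lambda>n x y. qtri_term n y x) = qtri_term"
    by (auto simp: fun_eq_iff qtri_term_def qmultinom_def ac_simps)
  then show ?thesis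
    using tri_sum_swap[OF tri_supported_qtri_term, of L a] by (simp add: qtrinom_eq_tri_sum)
qed

lemma qtrinom_neg: "L < 0 \<Longrightarrow> qtrinom L a = 0"
  by (simp add: qtrinom_eq_tri_sum tri_sum_neg)

lemma qtrinom_0: "qtrinom 0 a = of_bool (a = 0)"
  by (auto simp: qtrinom_eq_tri_sum tri_sum_def qtri_term_def qmultinom_def)

lemma one_minus_q_powi_nonzero: "L \<ge> 1 \<Longrightarrow> 1 - q powi L \<noteq> 0"
  by (metis mult_zero_right qpoch_nat_rec qpoch_nonzero)

text \<open>Holds term by term: multiplied by 1 - q^L it reads (1-N) + N Y (1-X) + N X (1-Y) + N
  (1-X) (1-Y) = 1 - N X Y, where N, X, Y are \<open>q\<close> to the powers \<open>n\<close>,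
  \<open>x\<close>, \<open>y\<close>.\<close>

lemma qtrinom_rec_L:
  assumes "L \<ge> 1"
  shows "qtrinom L a = qtrinom (L - 1) a + q powi (L + a) * qtrinom (L - 1) (a + 1)
    + q powi (L - a) * qtrinom (L - 1) (a - 1)
    + q powi (L - 1) * (1 - q powi (L - 1)) * qtrinom (L - 2) a"
proof -
  have *: "qtri_term n x y = qtri_term (n - 1) x y + q powi (L + a) * qtri_term n (x - 1) y
      + q powi (L - a) * qtri_term n x (y - 1)
      + q powi (L - 1) * (1 - q powi (L - 1)) * qtri_term n (x - 1) (y - 1)"
    if nxy: "n = L - 2 * x - a" "y = x + a" for n x y
  proof -
    have L: "n + x + y = L" using nxy by simp
    define Q where "Q = q powi (x * y)"
    define u where "u = 1 - q powi L"
    define v where "v = 1 - q powi (L - 1)"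
    have "u \<noteq> 0"
      unfolding u_def using assms by (rule one_minus_q_powi_nonzero)
    have cn: "u * qmultinom (n - 1) x y = (1 - q powi n) * qmultinom n x y"
      and cx: "u * qmultinom n (x - 1) y = (1 - q powi x) * qmultinom n x y"
      and cy: "u * qmultinom n x (y - 1) = (1 - q powi y) * qmultinom n x y"
      unfolding u_def L[symmetric]
      by (simp_all only: qmultinom_lower_n qmultinom_lower_x qmultinom_lower_y)
    have cxy: "v * qmultinom n (x - 1) (y - 1) = (1 - q powi y) * qmultinom n (x - 1) y"
      using qmultinom_lower_y[of y n "x - 1"] L by (simp add: v_def algebra_simps)
    have exps: "q powi (L + a) * q powi ((x - 1) * y) = q powi n * q powi y * Q"
      "q powi (L - a) * q powi (x * (y - 1)) = q powi n * q powi x * Q"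
      "q powi (L - 1) * q powi ((x - 1) * (y - 1)) = q powi n * Q"
      "q powi L = q powi n * q powi x * q powi y"
      unfolding Q_def q_powi_add[symmetric] by (simp_all add: nxy algebra_simps)
    have "u * (Q * qmultinom (n - 1) x y + q powi n * q powi y * Q * qmultinom n (x - 1) y
        + q powi n * q powi x * Q * qmultinom n x (y - 1)
        + q powi n * Q * (v * qmultinom n (x - 1) (y - 1))) =
        Q * (u * qmultinom (n - 1) x y) + q powi n * q powi y * Q * (u * qmultinom n (x - 1) y)
        + q powi n * q powi x * Q * (u * qmultinom n x (y - 1))
        + q powi n * Q * (1 - q powi y) * (u * qmultinom n (x - 1) y)"
      unfolding cxy by (simp add: algebra_simps)
    also have "\<dots> = u * (Q * qmultinom n x y)"
      unfolding cn cx cy unfolding u_def exps(4) by (simp add: algebra_simps)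
    finally have "Q * qmultinom n x y = Q * qmultinom (n - 1) x y
        + q powi n * q powi y * Q * qmultinom n (x - 1) y
        + q powi n * q powi x * Q * qmultinom n x (y - 1)
        + q powi n * Q * (v * qmultinom n (x - 1) (y - 1))"
      using \<open>u \<noteq> 0\<close> by (metis mult_cancel_left)
    then show ?thesis
      unfolding exps(1-3)[symmetric] unfolding v_def Q_def qtri_term_def by (simp add: ac_simps)
  qed
  have shift: "tri_sum (\<lambda>n x y. qtri_term n (x - 1) (y - 1)) L a = tri_sum qtri_term (L - 2) a"
  proof -
    have "tri_supported (\<lambda>n x y. qtri_term n (x - 1) y)"
      using tri_supported_qtri_term by (fastforce simp: tri_supported_def)
    from tri_sum_shift_y[OF this, of L a] show ?thesis
      by (simp add: tri_sum_shift_x[OF tri_supported_qtri_term])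
  qed
  have "tri_sum qtri_term L a = tri_sum (\<lambda>n x y. qtri_term (n - 1) x y) L a
      + q powi (L + a) * tri_sum (\<lambda>n x y. qtri_term n (x - 1) y) L a
      + q powi (L - a) * tri_sum (\<lambda>n x y. qtri_term n x (y - 1)) L a
      + q powi (L - 1) * (1 - q powi (L - 1)) * tri_sum (\<lambda>n x y. qtri_term n (x - 1) (y - 1)) L a"
    unfolding tri_sum_def sum_distrib_left sum.distrib[symmetric]
    by (intro sum.cong *) auto
  then show ?thesis
    unfolding shift tri_sum_shift_n[OF tri_supported_qtri_term]
      tri_sum_shift_x[OF tri_supported_qtri_term] tri_sum_shift_y[OF tri_supported_qtri_term]
    by (simp add: qtrinom_eq_tri_sum)
qed

text \<open>Term by term this is (1-Y) - (1-X) = X (1 - q^c), where X = q^x and Y = q^y = X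
  q^c.\<close>

lemma qtrinom_rec_a:
  "(1 - q powi c) * qtrinom L c =
     (1 - q powi L) * (qtrinom (L - 1) (c - 1) - q powi c * qtrinom (L - 1) (c + 1))"
proof -
  have *: "(1 - q powi c) * qtri_term n x y =
      (1 - q powi L) * (qtri_term n x (y - 1) - q powi c * qtri_term n (x - 1) y)"
    if nxy: "n = L - 2 * x - c" "y = x + c" for n x y
  proof -
    have L: "n + x + y = L" using nxy by simp
    have cx: "(1 - q powi L) * qmultinom n (x - 1) y = (1 - q powi x) * qmultinom n x y"
      and cy: "(1 - q powi L) * qmultinom n x (y - 1) = (1 - q powi y) * qmultinom n x y"
      unfolding L[symmetric] by (simp_all only: qmultinom_lower_x qmultinom_lower_y)
    define Q where "Q = q powi (x * (y - 1))"
    have exps: "q powi c * q powi ((x - 1) * y) = Q"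
      "q powi (x * y) = Q * q powi x" "q powi y = q powi x * q powi c"
      unfolding Q_def q_powi_add[symmetric] by (simp_all add: nxy algebra_simps)
    have "(1 - q powi L) * (Q * qmultinom n x (y - 1) - Q * qmultinom n (x - 1) y) =
        Q * ((1 - q powi L) * qmultinom n x (y - 1)) - Q * ((1 - q powi L) * qmultinom n (x - 1) y)"
      by (simp add: algebra_simps)
    also have "\<dots> = (1 - q powi c) * (Q * q powi x * qmultinom n x y)"
      unfolding cx cy exps(3) by (simp add: algebra_simps)
    finally show ?thesis
      unfolding qtri_term_def mult.assoc[symmetric] exps(1,2) unfolding Q_def by simp
  qed
  have "(1 - q powi c) * tri_sum qtri_term L c =
      (1 - q powi L) * (tri_sum (\<lambda>n x y. qtri_term n x (y - 1)) L c
        - q powi c * tri_sum (\<lambda>n x y. qtri_term n (x - 1) y) L c)"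
    unfolding tri_sum_def sum_distrib_left sum_subtractf[symmetric]
    by (intro sum.cong *) auto
  then show ?thesis
    by (simp add: qtrinom_eq_tri_sum tri_sum_shift_x[OF tri_supported_qtri_term]
        tri_sum_shift_y[OF tri_supported_qtri_term])
qed

section \<open>The second summation formula\<close>

definition antidiag_sum :: "int \<Rightarrow> (int \<Rightarrow> int \<Rightarrow> rat poly fract) \<Rightarrow> rat poly fract" where
  "antidiag_sum L h = (\<Sum>m\<in>{0..L}. h (L - m) m)"

lemma antidiag_sum_cong:
  "(\<And>l m. l + m = L \<Longrightarrow> 0 \<le> l \<Longrightarrow> 0 \<le> m \<Longrightarrow> h l m = h' l m) \<Longrightarrow> antidiag_sum L h = antidiag_sum L h'"
  unfolding antidiag_sum_def by (intro sum.cong) auto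

lemma antidiag_sum_add: "antidiag_sum L (\<lambda>l m. h l m + h' l m) = antidiag_sum L h + antidiag_sum L h'"
  by (simp add: antidiag_sum_def sum.distrib)

lemma antidiag_sum_diff: "antidiag_sum L (\<lambda>l m. h l m - h' l m) = antidiag_sum L h - antidiag_sum L h'"
  by (simp add: antidiag_sum_def sum_subtractf)

lemma antidiag_sum_cmult: "antidiag_sum L (\<lambda>l m. c * h l m) = c * antidiag_sum L h"
  by (simp add: antidiag_sum_def sum_distrib_left)

lemma antidiag_sum_shift_l:
  assumes "\<And>l m. l < 0 \<Longrightarrow> h l m = 0"
  shows "antidiag_sum L (\<lambda>l m. h (l - 1) m) = antidiag_sum (L - 1) h"
  unfolding antidiag_sum_def by (subst sum_drop_last) (simp_all add: assms algebra_simps)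

lemma antidiag_sum_shift_m:
  assumes "\<And>l m. m < 0 \<Longrightarrow> h l m = 0"
  shows "antidiag_sum L (\<lambda>l m. h l (m - 1)) = antidiag_sum (L - 1) h"
  unfolding antidiag_sum_def by (subst sum_drop_first) (simp_all add: assms algebra_simps)

lemma antidiag_sum_rtrinom_shift:
  "antidiag_sum L (\<lambda>l m. rtrinom (l - 1) m a b) = antidiag_sum (L - 1) (\<lambda>l m. rtrinom l m a b)"
  "antidiag_sum L (\<lambda>l m. rtrinom l (m - 1) a b) = antidiag_sum (L - 1) (\<lambda>l m. rtrinom l m a b)"
  "antidiag_sum L (\<lambda>l m. rtrinom (l - 1) (m - 1) a b) = antidiag_sum (L - 2) (\<lambda>l m. rtrinom l m a b)"
  "antidiag_sum L (\<lambda>l m. rtrinom (l - 2) m a b) = antidiag_sum (L - 2) (\<lambda>l m. rtrinom l m a b)"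
proof -
  show 1: "antidiag_sum L (\<lambda>l m. rtrinom (l - 1) m a b) = antidiag_sum (L - 1) (\<lambda>l m. rtrinom l m a b)" for L
    by (rule antidiag_sum_shift_l) (auto simp: rtrinom_neg)
  show 2: "antidiag_sum L (\<lambda>l m. rtrinom l (m - 1) a b) = antidiag_sum (L - 1) (\<lambda>l m. rtrinom l m a b)" for L
    by (rule antidiag_sum_shift_m) (auto simp: rtrinom_eq_0)
  show "antidiag_sum L (\<lambda>l m. rtrinom (l - 1) (m - 1) a b) = antidiag_sum (L - 2) (\<lambda>l m. rtrinom l m a b)"
    using antidiag_sum_shift_l[of "\<lambda>l m. rtrinom l (m - 1) a b" L] 2[of "L - 1"]
    by (simp add: rtrinom_neg)
  show "antidiag_sum L (\<lambda>l m. rtrinom (l - 2) m a b) = antidiag_sum (L - 2) (\<lambda>l m. rtrinom l m a b)"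
    using antidiag_sum_shift_l[of "\<lambda>l m. rtrinom (l - 1) m a b" L] 1[of "L - 1"]
    by (simp add: rtrinom_neg)
qed

text \<open>Summed over an antidiagonal, \<open>rtrinom_rec_b0\<close> becomes
  \<open>qtrinom_rec_L\<close>: the terms at \<open>(l - 2, m)\<close> and
  \<open>(l - 1, m - 1)\<close> both land on \<open>L - 2\<close> and combine to the factor q^(L-1)
  (1 - q^(L-1)).\<close>

lemma antidiag_sum_rtrinom_b0: "antidiag_sum L (\<lambda>l m. rtrinom l m a 0) = qtrinom L a"
proof (induction "nat L" arbitrary: L a rule: less_induct)
  case less
  consider "L < 0" | "L = 0" | "L \<ge> 1" by linarith
  then show ?case
  proof cases
    case 3
    have IH: "antidiag_sum L' (\<lambda>l m. rtrinom l m a' 0) = qtrinom L' a'" if "L' < L" for L' a'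
      using less.hyps[of L' a'] that 3 by simp
    have "antidiag_sum L (\<lambda>l m. rtrinom l m a 0) = antidiag_sum L (\<lambda>l m.
        q powi L * (q powi a * rtrinom (l - 1) m (a + 1) 0 + q powi (- a) * rtrinom (l - 1) m (a - 1) 0)
        - q powi (2 * L - 2) * rtrinom (l - 2) m a 0
        + rtrinom l (m - 1) a 0 + q powi (L - 1) * rtrinom (l - 1) (m - 1) a 0)"
      by (rule antidiag_sum_cong, rule rtrinom_rec_b0) (use 3 in auto)
    also have "\<dots> = q powi L * (q powi a * qtrinom (L - 1) (a + 1) + q powi (- a) * qtrinom (L - 1) (a - 1))
        - q powi (2 * L - 2) * qtrinom (L - 2) a
        + qtrinom (L - 1) a + q powi (L - 1) * qtrinom (L - 2) a"
      by (simp only: antidiag_sum_add antidiag_sum_diff antidiag_sum_cmult antidiag_sum_rtrinom_shift)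
         (simp add: IH)
    also have "\<dots> = q powi L * q powi a * qtrinom (L - 1) (a + 1) + q powi L * q powi (- a) * qtrinom (L - 1) (a - 1)
        - q powi (2 * L - 2) * qtrinom (L - 2) a
        + qtrinom (L - 1) a + q powi (L - 1) * qtrinom (L - 2) a"
      by (simp only: distrib_left mult.assoc)
    also have "q powi L * q powi a = q powi (L + a)"
      by (simp add: q_powi_add)
    also have "q powi L * q powi (- a) = q powi (L - a)"
      by (simp add: q_powi_add[symmetric])
    also have "q powi (2 * L - 2) = q powi (L - 1) * q powi (L - 1)"
      by (simp add: q_powi_add[symmetric])
    also have "q powi (L + a) * qtrinom (L - 1) (a + 1) + q powi (L - a) * qtrinom (L - 1) (a - 1)
        - q powi (L - 1) * q powi (L - 1) * qtrinom (L - 2) a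
        + qtrinom (L - 1) a + q powi (L - 1) * qtrinom (L - 2) a = qtrinom L a"
      unfolding qtrinom_rec_L[OF 3, of a] by (simp add: algebra_simps)
    finally show ?thesis .
  qed (auto simp: antidiag_sum_def qtrinom_neg qtrinom_0 rtrinom_L0)
qed

text \<open>The double induction of \<open>burge_rtrinom\<close> again; the summed
  \<open>rtrinom_lower_b\<close> is now solved by \<open>qtrinom_rec_a\<close> at index
  \<open>a + b\<close>.\<close>

lemma antidiag_sum_rtrinom:
  assumes "a \<ge> 0"
  shows "antidiag_sum L (\<lambda>l m. rtrinom l m a (int b)) = qtrinom L (a + int b)"
  using assms
proof (induction b arbitrary: L a)
  case 0
  then show ?case by (simp add: antidiag_sum_rtrinom_b0)
next
  case (Suc b)
  define c where "c = int (Suc b)"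
  have c: "int b = c - 1" "c \<ge> 1" by (auto simp: c_def)
  have prev: "antidiag_sum L (\<lambda>l m. rtrinom l m a (c - 1)) = qtrinom L (a + (c - 1))"
    if "a \<ge> 0" for L a
    using Suc.IH[OF that, of L] by (simp add: c)
  have "antidiag_sum L (\<lambda>l m. rtrinom l m a c) = qtrinom L (a + c)"
    using \<open>a \<ge> 0\<close>
  proof (induction "nat L" arbitrary: L a rule: less_induct)
    case less
    consider "L < 0" | "L = 0" | "L \<ge> 1" by linarith
    then show ?case
    proof cases
      case 3
      have IH: "antidiag_sum (L - 1) (\<lambda>l m. rtrinom l m (a + 1) c) = qtrinom (L - 1) (a + 1 + c)"
        using less.hyps[of "L - 1" "a + 1"] 3 less.prems by simp
      have "antidiag_sum L (\<lambda>l m. rtrinom l m a c - q powi (L + a + c) * rtrinom (l - 1) m (a + 1) c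
            + q powi (a + c) * rtrinom l (m - 1) (a + 1) c) =
          antidiag_sum L (\<lambda>l m. q powi (a + c) * rtrinom l m (a + 1) (c - 1)
            - q powi L * rtrinom (l - 1) m a (c - 1) + rtrinom l (m - 1) a (c - 1))"
      proof (rule antidiag_sum_cong)
        fix l m :: int
        assume "l + m = L" "0 \<le> l" "0 \<le> m"
        then show "rtrinom l m a c - q powi (L + a + c) * rtrinom (l - 1) m (a + 1) c
            + q powi (a + c) * rtrinom l (m - 1) (a + 1) c =
          q powi (a + c) * rtrinom l m (a + 1) (c - 1)
            - q powi L * rtrinom (l - 1) m a (c - 1) + rtrinom l (m - 1) a (c - 1)"
          using rtrinom_lower_b[of c a m l] c(2) less.prems by (simp add: add.commute)
      qed
      then have "antidiag_sum L (\<lambda>l m. rtrinom l m a c) - q powi (L + a + c) * qtrinom (L - 1) (a + 1 + c)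
            + q powi (a + c) * qtrinom (L - 1) (a + 1 + c) =
          q powi (a + c) * qtrinom L (a + 1 + (c - 1))
            - q powi L * qtrinom (L - 1) (a + (c - 1)) + qtrinom (L - 1) (a + (c - 1))"
        using less.prems
        by (simp only: antidiag_sum_add antidiag_sum_diff antidiag_sum_cmult antidiag_sum_rtrinom_shift
            IH prev add_nonneg_nonneg zero_le_one)
      moreover have "(1 - q powi (a + c)) * qtrinom L (a + c) =
          (1 - q powi L) * (qtrinom (L - 1) (a + (c - 1)) - q powi (a + c) * qtrinom (L - 1) (a + 1 + c))"
        using qtrinom_rec_a[of "a + c" L] by (simp add: algebra_simps)
      moreover have "q powi (L + a + c) = q powi L * q powi (a + c)"
        by (simp add: q_powi_add)
      moreover have "a + 1 + (c - 1) = a + c" by simp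
      ultimately show ?thesis by (simp add: algebra_simps)
    qed (use less.prems c(2) in \<open>auto simp: antidiag_sum_def qtrinom_neg qtrinom_0 rtrinom_L0\<close>)
  qed
  then show ?case by (simp add: c_def)
qed

section \<open>The initial identity\<close>

definition base_term :: "int \<Rightarrow> int \<Rightarrow> int \<Rightarrow> rat poly fract" where
  "base_term L M j = q powi (6 * j * j - j) * rtrinom L M (3 * j) j
     - q powi (6 * j * j + 7 * j + 2) * rtrinom L M (3 * j + 2) j"

text \<open>
  A certificate for telescoping in \<open>j\<close>, found from the generating function of \<open>T(L,M;a,b)\<close> in
  \<open>z^L w^a\<close>, which is \<open>(-z q^(1/2); q)\<^sub>M / ((z/w; q)\<^sub>M\<^sub>+\<^sub>b\<^sub>+\<^sub>1 (z w; q)\<^sub>M\<^sub>-\<^sub>b\<^sub>+\<^sub>1)\<close> up to the normalisation.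
\<close>

definition base_cert :: "int \<Rightarrow> int \<Rightarrow> int \<Rightarrow> rat poly fract" where
  "base_cert L M j =
     - (q powi (M + L + 6 * j * j - 5 * j) * rtri (M - 1) (M + j - 1) (M - j) (L - 1) (3 * j - 1)
      + q powi (M + L - 1 + 6 * j * j - j) * rtri (M - 1) (M + j - 1) (M - j) (L - 1) (3 * j))"

text \<open>After contractions in \<open>N\<close>, \<open>A\<close> and \<open>B\<close>, all terms
  cancel except those with exactly one of \<open>A\<close> and \<open>B\<close> lowered, which form
  the two certificate values.\<close>

lemma base_term_diff:
  assumes "M \<ge> 1"
  shows "base_term L M j - base_term L (M - 1) j = base_cert L M (j + 1) - base_cert L M j"
proof -
  define S where "S = rtri (M - 1) (M + j) (M - j)"
  define SA where "SA = rtri (M - 1) (M + j - 1) (M - j)"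
  \<comment> \<open>\<open>SB\<close> is \<open>SA\<close> with \<open>j + 1\<close> for
    \<open>j\<close>; this makes the difference telescope.\<close>
  define SB where "SB = rtri (M - 1) (M + j) (M - j - 1)"
  \<comment> \<open>The bound on \<open>a\<close> keeps the contraction admissible:
    \<open>M + j = 0\<close> forces \<open>j < 0\<close>, hence \<open>a < 0\<close>. Likewise in
    \<open>contract_B\<close>, \<open>M - j = 0\<close> forces \<open>a > 0\<close>.\<close>
  have contract_A: "S L a = SA L a + q powi (M + j + L + a) * S (L - 1) (a + 1)"
    if "a \<le> 3 * j + 2" for L a
    unfolding S_def SA_def using assms that by (intro rtri_contract_A) auto
  have contract_B: "S L a = SB L a + q powi (M - j + L - a) * S (L - 1) (a - 1)"
    if "a \<ge> 3 * j" for L a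
    unfolding S_def SB_def using assms that by (intro rtri_contract_B) auto
  have diff: "rtrinom L M a j - rtrinom L (M - 1) a j =
      q powi (M - j + L - a) * SA (L - 1) (a - 1) + q powi (M + j + L + a) * S (L - 1) (a + 1)
      + q powi (M + L - 1) * S (L - 1) a"
    if "3 * j \<le> a" "a \<le> 3 * j + 2" for a
  proof -
    have "rtrinom L M a j = S L a + q powi (M + L - 1) * S (L - 1) a"
      unfolding rtrinom_def S_def using assms by (intro rtri_contract_N) auto
    moreover have "SA L a = rtrinom L (M - 1) a j + q powi (M - j + L - a) * SA (L - 1) (a - 1)"
      using rtri_contract_B[of "M - j" a "M - 1" "M + j - 1" L] assms that
      by (auto simp: SA_def rtrinom_def algebra_simps)
    ultimately show ?thesis
      using contract_A[of a L] that by simp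
  qed
  define P where "P = q powi (M + L - 1 + 6 * j * j - j)"
  have P: "P * q powi e = q powi (M + L - 1 + 6 * j * j - j + e)" for e
    by (simp add: P_def q_powi_add)
  have "base_term L M j - base_term L (M - 1) j =
      q powi (6 * j * j - j) * (rtrinom L M (3 * j) j - rtrinom L (M - 1) (3 * j) j)
      - q powi (6 * j * j + 7 * j + 2) * (rtrinom L M (3 * j + 2) j - rtrinom L (M - 1) (3 * j + 2) j)"
    by (simp add: base_term_def algebra_simps)
  also have "\<dots> = P * (q powi (1 - 4 * j) * SA (L - 1) (3 * j - 1) + q powi (1 + 4 * j) * S (L - 1) (3 * j + 1)
        + S (L - 1) (3 * j)
      - (q powi (4 * j + 1) * SA (L - 1) (3 * j + 1) + q powi (12 * j + 5) * S (L - 1) (3 * j + 3)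
        + q powi (8 * j + 2) * S (L - 1) (3 * j + 2)))"
  proof -
    have "q powi (6 * j * j - j) * (rtrinom L M (3 * j) j - rtrinom L (M - 1) (3 * j) j) =
        P * (q powi (1 - 4 * j) * SA (L - 1) (3 * j - 1) + q powi (1 + 4 * j) * S (L - 1) (3 * j + 1)
        + S (L - 1) (3 * j))"
      unfolding diff[of "3 * j", simplified] distrib_left mult.assoc[symmetric] P q_powi_add[symmetric]
      by (simp add: P_def algebra_simps)
    moreover have "q powi (6 * j * j + 7 * j + 2) *
          (rtrinom L M (3 * j + 2) j - rtrinom L (M - 1) (3 * j + 2) j) =
        P * (q powi (4 * j + 1) * SA (L - 1) (3 * j + 1) + q powi (12 * j + 5) * S (L - 1) (3 * j + 3)
        + q powi (8 * j + 2) * S (L - 1) (3 * j + 2))"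
      unfolding diff[of "3 * j + 2", simplified] distrib_left mult.assoc[symmetric] P q_powi_add[symmetric]
      by (simp add: algebra_simps)
    ultimately show ?thesis by (simp only: right_diff_distrib)
  qed
  also have "\<dots> = P * (q powi (1 - 4 * j) * SA (L - 1) (3 * j - 1) + SA (L - 1) (3 * j)
      - q powi (8 * j + 2) * SB (L - 1) (3 * j + 2) - q powi (12 * j + 5) * SB (L - 1) (3 * j + 3))"
  proof -
    \<comment> \<open>\<open>u\<close> and \<open>v\<close> are correction terms of the
      contractions: each arises once from \<open>A\<close> and once, with opposite sign, from
      \<open>B\<close>.\<close>
    define u where "u = q powi (8 * j + M + L + 1) * S (L - 2) (3 * j + 2)"
    define v where "v = q powi (4 * j + M + L - 1) * S (L - 2) (3 * j + 1)"
    have "q powi (1 + 4 * j) * S (L - 1) (3 * j + 1) = q powi (4 * j + 1) * SA (L - 1) (3 * j + 1) + u"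
      unfolding contract_A[of "3 * j + 1" "L - 1", simplified] distrib_left mult.assoc[symmetric]
        q_powi_add[symmetric] u_def
      by (simp add: algebra_simps)
    moreover have "S (L - 1) (3 * j) = SA (L - 1) (3 * j) + v"
      using contract_A[of "3 * j" "L - 1"] by (simp add: v_def algebra_simps)
    moreover have "q powi (12 * j + 5) * S (L - 1) (3 * j + 3) = q powi (12 * j + 5) * SB (L - 1) (3 * j + 3) + u"
      unfolding contract_B[of "3 * j + 3" "L - 1", simplified] distrib_left mult.assoc[symmetric]
        q_powi_add[symmetric] u_def
      by (simp add: algebra_simps)
    moreover have "q powi (8 * j + 2) * S (L - 1) (3 * j + 2) = q powi (8 * j + 2) * SB (L - 1) (3 * j + 2) + v"
      unfolding contract_B[of "3 * j + 2" "L - 1", simplified] distrib_left mult.assoc[symmetric]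
        q_powi_add[symmetric] v_def
      by (simp add: algebra_simps)
    ultimately show ?thesis by simp
  qed
  also have "\<dots> = base_cert L M (j + 1) - base_cert L M j"
    unfolding distrib_left right_diff_distrib mult.assoc[symmetric] P base_cert_def
    by (simp add: P_def SA_def SB_def algebra_simps)
  finally show ?thesis .
qed

lemma base_cert_eq_0:
  assumes "j \<le> - M \<or> j > M"
  shows "base_cert L M j = 0"
proof -
  have "rtri (M - 1) (M + j - 1) (M - j) L' a = 0" for L' a
    by (rule rtri_eq_0) (use assms in auto)
  then show ?thesis by (simp add: base_cert_def)
qed

text \<open>For \<open>M = 0\<close> only \<open>j = 0\<close> survives. The increment in
  \<open>M\<close> telescopes to zero, as the certificate vanishes at \<open>- K\<close> and
  \<open>K + 1\<close>.\<close>

lemma sum_base_term: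
  assumes "int M \<le> K"
  shows "(\<Sum>j\<in>{- K..K}. base_term L (int M) j) = of_bool (L = 0)"
  using assms
proof (induction M)
  case 0
  have "(\<Sum>j\<in>{- K..K}. base_term L 0 j) = (\<Sum>j\<in>{0}. base_term L 0 j)"
    by (rule sum.mono_neutral_right) (use 0 in \<open>auto simp: base_term_def rtrinom_eq_0\<close>)
  also have "\<dots> = rtrinom L 0 0 0 - q powi 2 * rtrinom L 0 2 0"
    by (simp add: base_term_def)
  also have "\<dots> = of_bool (L = 0)"
  proof -
    have right: "rtrinom L 0 a 0 = q powi (L - a) * rtrinom (L - 1) 0 (a - 1) 0" if "a > 0" for L a
      using rtri_contract_B[of 0 a 0 0 L] that by (simp add: rtrinom_def rtri_eq_0)
    \<comment> \<open>Two contractions in \<open>B\<close> lead from \<open>a = 2\<close> to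
      \<open>a = 0\<close>; for \<open>L \<ge> 1\<close> the two terms then cancel by
      \<open>rtrinom_centre_rec\<close>.\<close>
    have "rtrinom L 0 2 0 = q powi (L - 2) * (q powi (L - 2) * rtrinom (L - 2) 0 0 0)"
      using right[of 2 L] right[of 1 "L - 1"] by simp
    then have *: "q powi 2 * rtrinom L 0 2 0 = q powi (2 * L - 2) * rtrinom (L - 2) 0 0 0"
      by (simp only: mult.assoc[symmetric] q_powi_add[symmetric]) simp
    show ?thesis
    proof (cases "L \<ge> 1")
      case True
      then show ?thesis
        unfolding * using rtrinom_centre_rec[OF True] by simp
    next
      case False
      then have "rtrinom (L - 2) 0 0 0 = 0" "rtrinom L 0 0 0 = of_bool (L = 0)"
        by (auto simp: rtrinom_neg rtrinom_L0 not_le)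
      then show ?thesis unfolding * by simp
    qed
  qed
  finally show ?case by simp
next
  case (Suc M)
  let ?G = "base_cert L (int (Suc M))"
  have "(\<Sum>j\<in>{- K..K}. ?G (j + 1)) = (\<Sum>j\<in>{- K + 1..K + 1}. ?G j)"
    by (rule sum.reindex_bij_witness[of _ "\<lambda>j. j - 1" "\<lambda>j. j + 1"]) auto
  also have "\<dots> = (\<Sum>j\<in>{- K..K + 1}. ?G j)"
    by (rule sum.mono_neutral_left) (use Suc.prems in \<open>auto intro!: base_cert_eq_0\<close>)
  also have "\<dots> = (\<Sum>j\<in>{- K..K}. ?G j)"
    by (rule sum.mono_neutral_right) (use Suc.prems in \<open>auto intro!: base_cert_eq_0\<close>)
  finally have "(\<Sum>j\<in>{- K..K}. base_term L (int (Suc M)) j - base_term L (int M) j) = 0"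
    using base_term_diff[of "int (Suc M)" L] by (simp add: sum_subtractf)
  then show ?case
    using Suc by (simp add: sum_subtractf)
qed

section \<open>Summation formulas over finite sums and for arguments of either sign\<close>

lemma burge_sum: "burge L M (\<lambda>l m. \<Sum>j\<in>J. h j l m) = (\<Sum>j\<in>J. burge L M (h j))"
  unfolding burge_def sum_distrib_left by (rule sum.swap)

lemma antidiag_sum_sum: "antidiag_sum L (\<lambda>l m. \<Sum>j\<in>J. h j l m) = (\<Sum>j\<in>J. antidiag_sum L (h j))"
  unfolding antidiag_sum_def by (rule sum.swap)

lemma burge_rtrinom_signed:
  assumes "M \<ge> 0" "0 \<le> a \<and> 0 \<le> b \<or> a \<le> 0 \<and> b \<le> 0"
  shows "burge L M (\<lambda>l m. rtrinom l m a b) = q powi (b * (a + b)) * rtrinom L M (a + b) b"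
  using assms(2)
proof
  assume "0 \<le> a \<and> 0 \<le> b"
  then show ?thesis
    using burge_rtrinom[of M a L "nat b"] assms(1) by simp
next
  assume *: "a \<le> 0 \<and> b \<le> 0"
  have "burge L M (\<lambda>l m. rtrinom l m a b) = burge L M (\<lambda>l m. rtrinom l m (- a) (- b))"
    by (simp only: rtrinom_minus)
  also have "\<dots> = q powi (- b * (- a + - b)) * rtrinom L M (- a + - b) (- b)"
    using burge_rtrinom[of M "- a" L "nat (- b)"] assms(1) * by simp
  also have "- b * (- a + - b) = b * (a + b)"
    by (simp add: algebra_simps)
  also have "- a + - b = - (a + b)"
    by simp
  finally show ?thesis by (simp only: rtrinom_minus)
qed

lemma antidiag_sum_rtrinom_signed:
  assumes "0 \<le> a \<and> 0 \<le> b \<or> a \<le> 0 \<and> b \<le> 0"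
  shows "antidiag_sum L (\<lambda>l m. rtrinom l m a b) = qtrinom L (a + b)"
  using assms
proof
  assume "0 \<le> a \<and> 0 \<le> b"
  then show ?thesis
    using antidiag_sum_rtrinom[of a L "nat b"] by simp
next
  assume *: "a \<le> 0 \<and> b \<le> 0"
  have "antidiag_sum L (\<lambda>l m. rtrinom l m a b) = antidiag_sum L (\<lambda>l m. rtrinom l m (- a) (- b))"
    by (simp only: rtrinom_minus)
  also have "\<dots> = qtrinom L (- a + - b)"
    using antidiag_sum_rtrinom[of "- a" L "nat (- b)"] * by simp
  also have "- a + - b = - (a + b)"
    by simp
  finally show ?thesis by (simp only: qtrinom_minus)
qed

section \<open>Iteration\<close>

text \<open>The right side of the initial identity under \<open>k\<close> applications of
  \<open>burge\<close>. The condition \<open>0 \<le> M\<close> makes level 0 vanish for negative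
  \<open>M\<close>, as the higher levels do, so ranges of summation can be extended.\<close>

primrec fermi :: "nat \<Rightarrow> int \<Rightarrow> int \<Rightarrow> rat poly fract" where
  "fermi 0 L M = of_bool (L = 0 \<and> 0 \<le> M)"
| "fermi (Suc k) L M = burge L M (fermi k)"

text \<open>The linear term has the sign opposite to the theorem's; \<open>bosonic_side\<close>
  replaces \<open>j\<close> by \<open>- j\<close>.\<close>

definition bose_exp1 :: "nat \<Rightarrow> int \<Rightarrow> int" where
  "bose_exp1 k j = j * ((int k + 3) * (int k + 4) * j - 2) div 2"

definition bose_exp2 :: "nat \<Rightarrow> int \<Rightarrow> int" where
  "bose_exp2 k j = ((int k + 3) * j + 2) * ((int k + 4) * j + 2) div 2"

lemma double_bose_exp:
  "2 * bose_exp1 k j = j * ((int k + 3) * (int k + 4) * j - 2)"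
  "2 * bose_exp2 k j = ((int k + 3) * j + 2) * ((int k + 4) * j + 2)"
  unfolding bose_exp1_def bose_exp2_def by (rule dvd_mult_div_cancel, auto)+

text \<open>The increments are the exponents \<open>b * (a + b)\<close> of the first summation
  formula at \<open>b = j\<close> and the two values of \<open>a\<close> in
  \<open>bose_term\<close>.\<close>

lemma bose_exp_Suc:
  "bose_exp1 (Suc k) j = bose_exp1 k j + j * ((int k + 3) * j + j)"
  "bose_exp2 (Suc k) j = bose_exp2 k j + j * ((int k + 3) * j + 2 + j)"
proof -
  have "2 * bose_exp1 (Suc k) j = 2 * (bose_exp1 k j + j * ((int k + 3) * j + j))"
    "2 * bose_exp2 (Suc k) j = 2 * (bose_exp2 k j + j * ((int k + 3) * j + 2 + j))"
    unfolding distrib_left[of 2] double_bose_exp by (simp_all add: algebra_simps)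
  then show "bose_exp1 (Suc k) j = bose_exp1 k j + j * ((int k + 3) * j + j)"
    "bose_exp2 (Suc k) j = bose_exp2 k j + j * ((int k + 3) * j + 2 + j)"
    by simp_all
qed

definition bose_term :: "nat \<Rightarrow> int \<Rightarrow> int \<Rightarrow> int \<Rightarrow> rat poly fract" where
  "bose_term k j L M = q powi bose_exp1 k j * rtrinom L M ((int k + 3) * j) j
     - q powi bose_exp2 k j * rtrinom L M ((int k + 3) * j + 2) j"

text \<open>The sign condition of the summation formulas. The shift by 2 does no harm, because
  \<open>(int k + 3) * j \<le> -3\<close> for \<open>j < 0\<close>.\<close>

lemma same_sign:
  fixes j :: int
  shows "0 \<le> (int k + 3) * j \<and> 0 \<le> j \<or> (int k + 3) * j \<le> 0 \<and> j \<le> 0"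
    and "0 \<le> (int k + 3) * j + 2 \<and> 0 \<le> j \<or> (int k + 3) * j + 2 \<le> 0 \<and> j \<le> 0"
proof -
  have "(int k + 3) * j \<le> 3 * j" if "j \<le> 0"
    using that by (intro mult_right_mono_neg) auto
  moreover have "(int k + 3) * j \<ge> 0" if "j \<ge> 0"
    using that by simp
  ultimately show "0 \<le> (int k + 3) * j \<and> 0 \<le> j \<or> (int k + 3) * j \<le> 0 \<and> j \<le> 0"
    "0 \<le> (int k + 3) * j + 2 \<and> 0 \<le> j \<or> (int k + 3) * j + 2 \<le> 0 \<and> j \<le> 0"
    by linarith+
qed

lemma fermi_eq_bose:
  assumes "0 \<le> M" "M \<le> K" "L \<le> K"
  shows "fermi k L M = (\<Sum>j\<in>{- K..K}. bose_term k j L M)"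
  using assms
proof (induction k arbitrary: L M)
  case 0
  have "bose_term 0 j L M = base_term L M j" for j
  proof -
    have "bose_exp1 0 j = 6 * j * j - j" "bose_exp2 0 j = 6 * j * j + 7 * j + 2"
      using double_bose_exp[of 0 j] by (simp_all add: algebra_simps)
    then show ?thesis by (simp add: bose_term_def base_term_def)
  qed
  then show ?case
    using sum_base_term[of "nat M" K L] 0 by simp
next
  case (Suc k)
  have step: "burge L M (bose_term k j) = bose_term (Suc k) j L M" for j
  proof -
    have "burge L M (bose_term k j) =
        q powi bose_exp1 k j * (q powi (j * ((int k + 3) * j + j)) * rtrinom L M ((int k + 3) * j + j) j)
        - q powi bose_exp2 k j *
          (q powi (j * ((int k + 3) * j + 2 + j)) * rtrinom L M ((int k + 3) * j + 2 + j) j)"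
      using burge_rtrinom_signed[OF Suc.prems(1) same_sign(1)[of k j], of L]
        burge_rtrinom_signed[OF Suc.prems(1) same_sign(2)[of k j], of L]
      unfolding bose_term_def burge_diff burge_cmult by simp
    moreover have "(int k + 3) * j + j = (int (Suc k) + 3) * j"
      "(int k + 3) * j + 2 + j = (int (Suc k) + 3) * j + 2"
      by (simp_all add: algebra_simps)
    ultimately show ?thesis
      unfolding bose_term_def bose_exp_Suc q_powi_add by (simp only: mult.assoc)
  qed
  have "fermi (Suc k) L M = burge L M (\<lambda>l m. \<Sum>j\<in>{- K..K}. bose_term k j l m)"
    \<comment> \<open>\<open>burge\<close> evaluates at nonnegative \<open>l\<close>,
      \<open>m\<close> with \<open>l + m = L \<le> K\<close>, so one \<open>K\<close> serves all
      levels.\<close>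
    unfolding fermi.simps by (rule burge_cong, rule Suc.IH) (use Suc.prems in auto)
  then show ?case
    by (simp add: burge_sum step)
qed

lemma antidiag_sum_fermi:
  assumes "L \<le> K"
  shows "antidiag_sum L (fermi n) = (\<Sum>j\<in>{- K..K}. q powi bose_exp1 n j * qtrinom L ((int n + 4) * j)
    - q powi bose_exp2 n j * qtrinom L ((int n + 4) * j + 2))"
proof -
  have step: "antidiag_sum L (bose_term n j) = q powi bose_exp1 n j * qtrinom L ((int n + 4) * j)
    - q powi bose_exp2 n j * qtrinom L ((int n + 4) * j + 2)" for j
  proof -
    have "antidiag_sum L (bose_term n j) = q powi bose_exp1 n j * qtrinom L ((int n + 3) * j + j)
        - q powi bose_exp2 n j * qtrinom L ((int n + 3) * j + 2 + j)"
      using antidiag_sum_rtrinom_signed[OF same_sign(1)[of n j], of L]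
        antidiag_sum_rtrinom_signed[OF same_sign(2)[of n j], of L]
      unfolding bose_term_def antidiag_sum_diff antidiag_sum_cmult by simp
    moreover have "(int n + 3) * j + j = (int n + 4) * j"
      "(int n + 3) * j + 2 + j = (int n + 4) * j + 2"
      by (simp_all add: algebra_simps)
    ultimately show ?thesis by simp
  qed
  have "antidiag_sum L (fermi n) = antidiag_sum L (\<lambda>l m. \<Sum>j\<in>{- K..K}. bose_term n j l m)"
    by (rule antidiag_sum_cong, rule fermi_eq_bose) (use assms in auto)
  then show ?thesis
    by (simp add: antidiag_sum_sum step)
qed

section \<open>The bosonic side\<close>

lemma bosonic_side:
  "sum' (\<lambda>j. q powi (j * ((int n + 3) * (int n + 4) * j + 2) div 2) * qtrinom L ((int n + 4) * j)
         - q powi (((int n + 3) * j + 2) * ((int n + 4) * j + 2) div 2) * qtrinom L ((int n + 4) * j + 2))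
       UNIV = antidiag_sum L (fermi n)"
proof -
  \<comment> \<open>The extra 2 absorbs the shift in \<open>(int n + 4) * j + 2\<close>.\<close>
  define K where "K = \<bar>L\<bar> + 2"
  have bound: "\<bar>j\<bar> \<le> \<bar>(int n + 4) * j\<bar>" for j
    using mult_right_mono[of 1 "int n + 4" "\<bar>j\<bar>"] by (simp add: abs_mult)
  have zero: "qtrinom L ((int n + 4) * j) = 0" "qtrinom L ((int n + 4) * j + 2) = 0"
    if "j \<notin> {- K..K}" for j
    using that bound[of j] qtrinom2_nonzeroD[of L "(int n + 4) * j" "(int n + 4) * j"]
      qtrinom2_nonzeroD[of L "(int n + 4) * j + 2" "(int n + 4) * j + 2"]
    unfolding K_def by fastforce+
  let ?f = "\<lambda>j. q powi (j * ((int n + 3) * (int n + 4) * j + 2) div 2) * qtrinom L ((int n + 4) * j)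
         - q powi (((int n + 3) * j + 2) * ((int n + 4) * j + 2) div 2) * qtrinom L ((int n + 4) * j + 2)"
  have "sum' ?f UNIV = sum' ?f {- K..K}"
    by (rule sum.mono_neutral_right') (auto simp: zero)
  also have "\<dots> = (\<Sum>j\<in>{- K..K}. ?f j)"
    by (rule sum.eq_sum) auto
  also have "\<dots> = (\<Sum>j\<in>{- K..K}. q powi (j * ((int n + 3) * (int n + 4) * j + 2) div 2) * qtrinom L ((int n + 4) * j))
      - (\<Sum>j\<in>{- K..K}. q powi bose_exp2 n j * qtrinom L ((int n + 4) * j + 2))"
    by (simp add: sum_subtractf bose_exp2_def)
  also have "(\<Sum>j\<in>{- K..K}. q powi (j * ((int n + 3) * (int n + 4) * j + 2) div 2) * qtrinom L ((int n + 4) * j)) =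
      (\<Sum>j\<in>{- K..K}. q powi bose_exp1 n j * qtrinom L ((int n + 4) * j))"
  \<comment> \<open>By \<open>qtrinom_minus\<close> the substitution of \<open>- j\<close> for
    \<open>j\<close> only changes the exponent, into that of the theorem.\<close>
  proof (rule sum.reindex_bij_witness[of _ uminus uminus])
    fix j :: int
    have "- j * ((int n + 3) * (int n + 4) * - j - 2) = j * ((int n + 3) * (int n + 4) * j + 2)"
      "(int n + 4) * - j = - ((int n + 4) * j)"
      by (simp_all add: algebra_simps)
    then show "q powi bose_exp1 n (- j) * qtrinom L ((int n + 4) * - j) =
        q powi (j * ((int n + 3) * (int n + 4) * j + 2) div 2) * qtrinom L ((int n + 4) * j)"
      by (simp only: bose_exp1_def qtrinom_minus)
  qed auto
  finally show ?thesis
    unfolding sum_subtractf[symmetric] by (simp add: antidiag_sum_fermi[of L K] K_def)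
qed

section \<open>The fermionic side as a sum over vectors\<close>

lemma fermi_neg: "M < 0 \<Longrightarrow> fermi k L M = 0"
  by (cases k) (auto simp: burge_def qbinom_gt intro!: sum.neutral)

text \<open>A range \<open>{0..N}\<close> independent of \<open>L\<close> lets nested sums merge
  into one sum over a box; the added terms have negative second argument.\<close>

lemma antidiag_sum_extend:
  assumes "L \<le> N" "\<And>l m. m < 0 \<Longrightarrow> h l m = 0"
  shows "antidiag_sum L h = (\<Sum>l\<in>{0..N}. h l (L - l))"
proof -
  have "antidiag_sum L h = (\<Sum>l\<in>{0..L}. h l (L - l))"
    unfolding antidiag_sum_def
    by (rule sum.reindex_bij_witness[of _ "\<lambda>l. L - l" "\<lambda>l. L - l"]) auto
  also have "\<dots> = (\<Sum>l\<in>{0..N}. h l (L - l))"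
    by (rule sum.mono_neutral_left) (use assms in auto)
  finally show ?thesis .
qed

lemma fermi_Suc_extend:
  assumes "L \<le> N"
  shows "fermi (Suc k) L M =
    (\<Sum>l\<in>{0..N}. q powi (L * (L - l)) * qbinom (M + l) L * fermi k l (L - l))"
proof -
  have "fermi (Suc k) L M = antidiag_sum L (\<lambda>l m. q powi (L * m) * qbinom (L + M - m) L * fermi k l m)"
    by (simp add: burge_def antidiag_sum_def)
  also have "\<dots> = (\<Sum>l\<in>{0..N}. q powi (L * (L - l)) * qbinom (L + M - (L - l)) L * fermi k l (L - l))"
    by (rule antidiag_sum_extend) (use assms in \<open>auto simp: fermi_neg\<close>)
  finally show ?thesis by simp
qed

lemma fermi_1:
  assumes "0 \<le> L"
  shows "fermi (Suc 0) L M = q powi (L * L) * qbinom M L"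
proof -
  have "fermi (Suc 0) L M = (\<Sum>l\<in>{0..L}. if l = 0 then q powi (L * L) * qbinom M L else 0)"
    unfolding fermi_Suc_extend[OF order_refl] by (intro sum.cong) (use assms in auto)
  with assms show ?thesis by simp
qed

lemma sum_PiE_insert:
  assumes "x \<notin> S"
  shows "(\<Sum>m\<in>Pi\<^sub>E (insert x S) (\<lambda>_. B). g m) = (\<Sum>m\<in>Pi\<^sub>E S (\<lambda>_. B). \<Sum>l\<in>B. g (m(x := l)))"
proof -
  have "(\<Sum>m\<in>Pi\<^sub>E (insert x S) (\<lambda>_. B). g m) = (\<Sum>(l, m)\<in>B \<times> Pi\<^sub>E S (\<lambda>_. B). g (m(x := l)))"
    unfolding PiE_insert_eq
    by (subst sum.reindex[OF inj_combinator[OF assms]]) (simp add: case_prod_unfold)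
  also have "\<dots> = (\<Sum>l\<in>B. \<Sum>m\<in>Pi\<^sub>E S (\<lambda>_. B). g (m(x := l)))"
    by (rule sum.cartesian_product[symmetric])
  finally show ?thesis
    by (subst sum.swap)
qed

text \<open>The kernel of \<open>fermi_Suc_extend\<close> at \<open>L = m i\<close>,
  \<open>M = m (i - 1) - m i\<close>, \<open>l = m (i + 1)\<close>. It is used with
  \<open>m 0\<close> set to \<open>L\<close>, so that \<open>i = 1\<close> needs no special
  treatment.\<close>

definition fermi_weight :: "(nat \<Rightarrow> int) \<Rightarrow> nat \<Rightarrow> rat poly fract" where
  "fermi_weight m i = q powi (m i * (m i - m (i + 1))) * qbinom (m (i - 1) - m i + m (i + 1)) (m i)"

text \<open>The entry \<open>m 1\<close> is the variable of \<open>antidiag_sum\<close>; each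
  induction step opens one \<open>burge\<close>, whose variable becomes the entry
  \<open>m (k + 2)\<close>.\<close>

lemma antidiag_sum_fermi_unroll:
  assumes "L \<le> N" "k < n"
  shows "antidiag_sum L (fermi n) = (\<Sum>m\<in>{1..k + 1} \<rightarrow>\<^sub>E {0..N}.
    (\<Prod>i=1..k. fermi_weight (m(0 := L)) i) * fermi (n - k) (m (k + 1)) ((m(0 := L)) k - m (k + 1)))"
  using assms(2)
proof (induction k)
  case 0
  have "(\<Sum>m\<in>{1..0 + 1} \<rightarrow>\<^sub>E {0..N}. (\<Prod>i=1..0. fermi_weight (m(0 := L)) i)
        * fermi (n - 0) (m (0 + 1)) ((m(0 := L)) 0 - m (0 + 1))) =
      (\<Sum>m\<in>insert (Suc 0) {} \<rightarrow>\<^sub>E {0..N}. fermi n (m (Suc 0)) (L - m (Suc 0)))"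
    by simp
  also have "\<dots> = (\<Sum>l\<in>{0..N}. fermi n l (L - l))"
    by (subst sum_PiE_insert) simp_all
  also have "\<dots> = antidiag_sum L (fermi n)"
    by (rule antidiag_sum_extend[symmetric]) (auto simp: assms(1) fermi_neg)
  finally show ?case by simp
next
  case (Suc k)
  have nk: "n - k = Suc (n - Suc k)" using Suc.prems by simp
  have "antidiag_sum L (fermi n) = (\<Sum>m\<in>{1..k + 1} \<rightarrow>\<^sub>E {0..N}.
      (\<Prod>i=1..k. fermi_weight (m(0 := L)) i) * fermi (n - k) (m (k + 1)) ((m(0 := L)) k - m (k + 1)))"
    using Suc.prems by (intro Suc.IH) simp
  also have "\<dots> = (\<Sum>m\<in>{1..k + 1} \<rightarrow>\<^sub>E {0..N}. \<Sum>l\<in>{0..N}.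
      (\<Prod>i=1..Suc k. fermi_weight (m(k + 2 := l, 0 := L)) i)
        * fermi (n - Suc k) ((m(k + 2 := l)) (k + 2)) ((m(k + 2 := l, 0 := L)) (k + 1) - (m(k + 2 := l)) (k + 2)))"
  proof (rule sum.cong[OF refl])
    fix m assume "m \<in> {1..k + 1} \<rightarrow>\<^sub>E {0..N}"
    then have mk: "m (k + 1) \<le> N" by auto
    have "(\<Prod>i=1..Suc k. fermi_weight (m(k + 2 := l, 0 := L)) i) =
        (\<Prod>i=1..k. fermi_weight (m(0 := L)) i) *
        (q powi (m (k + 1) * (m (k + 1) - l)) * qbinom ((m(0 := L)) k - m (k + 1) + l) (m (k + 1)))" for l
    proof -
      \<comment> \<open>The old weights look no further than entry \<open>k + 1\<close>, so the new
        entry leaves them unchanged.\<close>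
      have "(\<Prod>i=1..k. fermi_weight (m(k + 2 := l, 0 := L)) i) = (\<Prod>i=1..k. fermi_weight (m(0 := L)) i)"
        by (intro prod.cong) (auto simp: fermi_weight_def)
      then show ?thesis by (simp add: fermi_weight_def)
    qed
    then show "(\<Prod>i=1..k. fermi_weight (m(0 := L)) i) * fermi (n - k) (m (k + 1)) ((m(0 := L)) k - m (k + 1)) =
        (\<Sum>l\<in>{0..N}. (\<Prod>i=1..Suc k. fermi_weight (m(k + 2 := l, 0 := L)) i)
        * fermi (n - Suc k) ((m(k + 2 := l)) (k + 2)) ((m(k + 2 := l, 0 := L)) (k + 1) - (m(k + 2 := l)) (k + 2)))"
      unfolding nk fermi_Suc_extend[OF mk] sum_distrib_left
      by (intro sum.cong) (simp_all add: mult.assoc)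
  qed
  also have "\<dots> = (\<Sum>m\<in>{1..Suc k + 1} \<rightarrow>\<^sub>E {0..N}. (\<Prod>i=1..Suc k. fermi_weight (m(0 := L)) i)
      * fermi (n - Suc k) (m (Suc k + 1)) ((m(0 := L)) (Suc k) - m (Suc k + 1)))"
  proof -
    have "{1..Suc k + 1} = insert (k + 2) {1..k + 1}" by auto
    then show ?thesis
      by (simp only:) (subst sum_PiE_insert; simp)
  qed
  finally show ?case .
qed

text \<open>Splits the power of \<open>q\<close> into the exponents occurring in
  \<open>fermi_weight\<close>, with the neighbour beyond \<open>n\<close> read as 0.\<close>

lemma half_cartan_form:
  "cartan_form n m div 2 = (\<Sum>j=1..n. m j * (m j - (if j < n then m (j + 1) else 0)))"
proof -
  have "cartan_form n m = 2 * (\<Sum>j=1..n. m j * (m j - (if j < n then m (j + 1) else 0)))"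
  proof (induction n)
    case 0
    then show ?case by (simp add: cartan_form_def)
  next
    case (Suc n)
    define c where "c = (if n = 0 then 0 else m n * m (Suc n))"
    have upper: "(\<Sum>j=1..n. m j * cartan_A j (Suc n) * m (Suc n)) = - c"
    proof -
      have "(\<Sum>j=1..n. m j * cartan_A j (Suc n) * m (Suc n)) = (\<Sum>j=1..n. if j = n then - (m n * m (Suc n)) else 0)"
        by (intro sum.cong) (auto simp: cartan_A_def)
      then show ?thesis by (simp add: c_def)
    qed
    moreover have "(\<Sum>k=1..n. m (Suc n) * cartan_A (Suc n) k * m k)
        = (\<Sum>j=1..n. m j * cartan_A j (Suc n) * m (Suc n))"
      by (intro sum.cong) (auto simp: cartan_A_def)
    moreover have "cartan_A (Suc n) (Suc n) = 2"
      by (simp add: cartan_A_def)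
    ultimately have "cartan_form (Suc n) m = cartan_form n m - 2 * c + 2 * (m (Suc n) * m (Suc n))"
      by (simp add: cartan_form_def sum.distrib)
    moreover have "(\<Sum>j=1..n. m j * (m j - (if j < Suc n then m (j + 1) else 0))) =
        (\<Sum>j=1..n. m j * (m j - (if j < n then m (j + 1) else 0))) - c"
    proof -
      have "(\<Sum>j=1..n. m j * (m j - (if j < n then m (j + 1) else 0)) -
            m j * (m j - (if j < Suc n then m (j + 1) else 0))) =
          (\<Sum>j=1..n. if j = n then m n * m (Suc n) else 0)"
        by (intro sum.cong) (auto simp: algebra_simps)
      also have "\<dots> = c"
        by (simp add: c_def)
      finally show ?thesis by (simp add: sum_subtractf)
    qed
    ultimately show ?case
      using Suc.IH by simp
  qed
  then show ?thesis by simp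
qed

lemma fermionic_side:
  assumes "n \<ge> 1"
  shows "sum' (\<lambda>m. q powi (cartan_form n m div 2) *
             (\<Prod>j=1..n. qbinom (L * of_bool (j = 1) + m j - cartan_mult n m j) (m j)))
           (int_vectors n) = antidiag_sum L (fermi n)"
proof -
  obtain k where n: "n = Suc k" using assms by (cases n) auto
  let ?f = "\<lambda>m. q powi (cartan_form n m div 2) *
             (\<Prod>j=1..n. qbinom (L * of_bool (j = 1) + m j - cartan_mult n m j) (m j))"
  define S where "S = {m \<in> int_vectors n. ?f m \<noteq> 0}"
  have "finite S"
    unfolding S_def by (rule finite_support_vectors)
  then have "finite (insert L (\<Union>m\<in>S. m ` {1..n}))" by simp
  \<comment> \<open>\<open>N\<close> bounds \<open>L\<close> and all entries of vectors in the
    support, so a finite box carries the whole sum.\<close>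
  then obtain N where N: "x \<le> N" if "x \<in> insert L (\<Union>m\<in>S. m ` {1..n})" for x
    using Max_ge by blast
  have S_sub: "S \<subseteq> {1..n} \<rightarrow>\<^sub>E {0..N}"
  proof
    fix m assume m: "m \<in> S"
    have "0 \<le> m j" if "j \<in> {1..n}" for j
    proof -
      have "qbinom (L * of_bool (j = 1) + m j - cartan_mult n m j) (m j) \<noteq> 0"
        using m that by (auto simp: S_def)
      then show ?thesis by (auto dest: qbinom_nonzeroD)
    qed
    moreover have "m j \<le> N" if "j \<in> {1..n}" for j
      by (rule N) (use m that in blast)
    ultimately show "m \<in> {1..n} \<rightarrow>\<^sub>E {0..N}"
      using m by (auto simp: S_def PiE_iff)
  qed
  have "sum' ?f (int_vectors n) = sum' ?f ({1..n} \<rightarrow>\<^sub>E {0..N})"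
  proof (rule sum.mono_neutral_right')
    show "{1..n} \<rightarrow>\<^sub>E {0..N} \<subseteq> int_vectors n"
      by (auto simp: PiE_iff)
    show "\<forall>m\<in>int_vectors n - ({1..n} \<rightarrow>\<^sub>E {0..N}). ?f m = 0"
      using S_sub unfolding S_def by blast
  qed
  also have "\<dots> = (\<Sum>m\<in>{1..n} \<rightarrow>\<^sub>E {0..N}. ?f m)"
    by (rule sum.eq_sum) (auto intro: finite_PiE)
  also have "\<dots> = (\<Sum>m\<in>{1..k + 1} \<rightarrow>\<^sub>E {0..N}. (\<Prod>i=1..k. fermi_weight (m(0 := L)) i)
      * fermi (n - k) (m (k + 1)) ((m(0 := L)) k - m (k + 1)))"
  proof (rule sum.cong)
    fix m assume "m \<in> {1..k + 1} \<rightarrow>\<^sub>E {0..N}"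
    then have "0 \<le> m (k + 1)" by auto
    let ?\<mu> = "m(0 := L)"
    have "?f m = (\<Prod>j=1..n. q powi (m j * (m j - (if j < n then m (j + 1) else 0))) *
        qbinom (?\<mu> (j - 1) - m j + (if j < n then m (j + 1) else 0)) (m j))"
    proof -
      have "q powi (\<Sum>j=1..n. g j) = (\<Prod>j=1..n. q powi g j)" for g :: "nat \<Rightarrow> int"
        by (induction n) (simp_all add: q_powi_add)
      \<comment> \<open>The Cartan matrix yields the nearest-neighbour form of the weights, with
        \<open>L\<close> in the place of \<open>m 0\<close>.\<close>
      moreover have "L * of_bool (j = 1) + m j - cartan_mult n m j =
          ?\<mu> (j - 1) - m j + (if j < n then m (j + 1) else 0)" if "j \<in> {1..n}" for j
        using cartan_mult_expand[OF that, of m] that by auto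
      then have "(\<Prod>j=1..n. qbinom (L * of_bool (j = 1) + m j - cartan_mult n m j) (m j)) =
          (\<Prod>j=1..n. qbinom (?\<mu> (j - 1) - m j + (if j < n then m (j + 1) else 0)) (m j))"
        by (intro prod.cong[OF refl]) (simp only:)
      ultimately show ?thesis
        unfolding half_cartan_form prod.distrib by simp
    qed
    \<comment> \<open>The factor \<open>j = n\<close> has no right neighbour; it is the innermost
      level, evaluated by \<open>fermi_1\<close>.\<close>
    also have "\<dots> = (\<Prod>i=1..k. fermi_weight ?\<mu> i) * (q powi (m (k + 1) * m (k + 1)) *
        qbinom (?\<mu> k - m (k + 1)) (m (k + 1)))"
    proof -
      have "(\<Prod>j=1..k. q powi (m j * (m j - (if j < n then m (j + 1) else 0))) *
          qbinom (?\<mu> (j - 1) - m j + (if j < n then m (j + 1) else 0)) (m j)) =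
          (\<Prod>i=1..k. fermi_weight ?\<mu> i)"
        by (intro prod.cong) (auto simp: fermi_weight_def n)
      then show ?thesis
        by (simp add: n)
    qed
    also have "\<dots> = (\<Prod>i=1..k. fermi_weight ?\<mu> i) * fermi (n - k) (m (k + 1)) (?\<mu> k - m (k + 1))"
      using fermi_1[OF \<open>0 \<le> m (k + 1)\<close>] by (simp add: n del: fermi.simps)
    finally show "?f m = \<dots>" .
  qed (simp add: n)
  also have "\<dots> = antidiag_sum L (fermi n)"
    by (rule antidiag_sum_fermi_unroll[symmetric]) (use N n in auto)
  finally show ?thesis .
qed

theorem proposition4p5:
  fixes n :: nat and L :: int
  assumes "n \<ge> 1"
  shows "sum' (\<lambda>m. q powi (cartan_form n m div 2) *
             (\<Prod>j=1..n. qbinom (L * of_bool (j = 1) + m j - cartan_mult n m j) (m j)))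
           (int_vectors n)
       = sum' (\<lambda>j. q powi (j * ((int n + 3) * (int n + 4) * j + 2) div 2)
                     * qtrinom L ((int n + 4) * j)
                 - q powi (((int n + 3) * j + 2) * ((int n + 4) * j + 2) div 2)
                     * qtrinom L ((int n + 4) * j + 2))
           UNIV"
  unfolding fermionic_side[OF assms] bosonic_side ..

end
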